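(* Let $C$ be the non-complete intersection Gorenstein monomial curve $x_i=t^{n_i}$ ($1\le i\le4$) in $\mathbb{A}^4(K)$, with $n_1<n_2<n_3<n_4$. Suppose that $I(C)$ is given as in case 3(a), i.e. $I(C)$ is minimally generated by $$f_1=x_1^{a_1}-x_2^{a_{12}}x_4^{a_{14}},\quad f_2=x_2^{a_2}-x_1^{a_{21}}x_3^{a_{23}},\quad f_3=x_3^{a_3}-x_1^{a_{31}}x_4^{a_{34}},$$ $$f_4=x_4^{a_4}-x_2^{a_{42}}x_3^{a_{43}},\quad f_5=x_1^{a_{31}}x_2^{a_{42}}-x_3^{a_{23}}x_4^{a_{14}}.$$ Then $C$ has Cohen-Macaulay tangent cone at the origin if and only if $a_2\le a_{21}+a_{23}$ and $a_3\le a_{31}+a_{34}$.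
   Context: $K$ is a field and $n_1,\dots,n_4$ are positive integers with $\gcd(n_1,\dots,n_4)=1$. $I(C)$ is the kernel of the $K$-algebra homomorphism $K[x_1,\dots,x_4]\to K[t]$, $x_i\mapsto t^{n_i}$. $C$ is Gorenstein if the semigroup $\mathcal{S}=\{g_1n_1+\cdots+g_4n_4: g_i\in\mathbb{N}\}$ is symmetric ($\mathbb{N}$ = non-negative integers). In the description of $I(C)$, all exponents are integers with $0<a_{ij}<a_j$, and (by Bresinsky) $a_1=a_{21}+a_{31}$, $a_2=a_{12}+a_{42}$, $a_3=a_{23}+a_{43}$, $a_4=a_{14}+a_{34}$. $C$ has Cohen-Macaulay tangent cone at the origin if the ring $K[x_1,\dots,x_4]/I(C)_*$ is Cohen-Macaulay, where $I(C)_*$ is generated by the homogeneous (standard grading) summands $f_*$ of least degree of the polynomials $f\in I(C)$. *)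

theory Defs
  imports
    "HOL-Library.Numeral_Type"
    "HOL-Library.Extended_Nat"
    "HOL-Library.Poly_Mapping"
    "HOL-Computational_Algebra.Polynomial"
    "HOL-Algebra.Ring_Divisibility"
    "HOL-Algebra.QuotRing"
    "HOL-Algebra.Algebraic_Closure_Type"
begin

section \<open>Cohen-Macaulay rings\<close>

subsection \<open>Krull dimension and depth\<close>

definition krull_dim :: "('a, 'b) ring_scheme \<Rightarrow> enat" where
  "krull_dim R = Sup {enat d | d. \<exists>P :: nat \<Rightarrow> 'a set.
     (\<forall>i\<le>d. primeideal (P i) R) \<and> (\<forall>i<d. P i \<subset> P (Suc i))}"

definition regular_sequence :: "('a, 'b) ring_scheme \<Rightarrow> 'a list \<Rightarrow> bool" where
  "regular_sequence R xs \<longleftrightarrow>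
     set xs \<subseteq> carrier R \<and>
     (\<forall>i<length xs. \<forall>y\<in>carrier R.
        xs ! i \<otimes>\<^bsub>R\<^esub> y \<in> Idl\<^bsub>R\<^esub> (set (take i xs)) \<longrightarrow> y \<in> Idl\<^bsub>R\<^esub> (set (take i xs))) \<and>
     Idl\<^bsub>R\<^esub> (set xs) \<noteq> carrier R"

definition depth :: "'a set \<Rightarrow> ('a, 'b) ring_scheme \<Rightarrow> enat" where
  "depth I R = Sup {enat (length xs) | xs. set xs \<subseteq> I \<and> regular_sequence R xs}"

definition noetherian_local_ring :: "('a, 'b) ring_scheme \<Rightarrow> bool" where
  "noetherian_local_ring R \<longleftrightarrow> cring R \<and> noetherian_ring R \<and> (\<exists>!M. maximalideal M R)"

definition cohen_macaulay_local :: "('a, 'b) ring_scheme \<Rightarrow> bool" where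
  "cohen_macaulay_local R \<longleftrightarrow>
     noetherian_local_ring R \<and> depth (THE M. maximalideal M R) R = krull_dim R"

subsection \<open>Localization\<close>

text \<open>
  The ring of fractions of a commutative ring \<open>R\<close> at a multiplicative set \<open>S\<close>, which may
  contain zero divisors. Its elements are equivalence classes of pairs (numerator, denominator).
\<close>

definition fraction_rel :: "('a, 'b) ring_scheme \<Rightarrow> 'a set \<Rightarrow> (('a \<times> 'a) \<times> ('a \<times> 'a)) set" where
  "fraction_rel R S = {((a, s), (b, t)).
     a \<in> carrier R \<and> b \<in> carrier R \<and> s \<in> S \<and> t \<in> S \<and>
     (\<exists>u\<in>S. u \<otimes>\<^bsub>R\<^esub> (a \<otimes>\<^bsub>R\<^esub> t) = u \<otimes>\<^bsub>R\<^esub> (b \<otimes>\<^bsub>R\<^esub> s))}"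

definition fraction :: "('a, 'b) ring_scheme \<Rightarrow> 'a set \<Rightarrow> 'a \<Rightarrow> 'a \<Rightarrow> ('a \<times> 'a) set" where
  "fraction R S a s = fraction_rel R S `` {(a, s)}"

definition localization :: "('a, 'b) ring_scheme \<Rightarrow> 'a set \<Rightarrow> ('a \<times> 'a) set ring" where
  "localization R S =
     \<lparr>carrier = (carrier R \<times> S) // fraction_rel R S,
      monoid.mult = (\<lambda>U V. \<Union>(a, s)\<in>U. \<Union>(b, t)\<in>V. fraction R S (a \<otimes>\<^bsub>R\<^esub> b) (s \<otimes>\<^bsub>R\<^esub> t)),
      one = fraction R S \<one>\<^bsub>R\<^esub> \<one>\<^bsub>R\<^esub>,
      ring.zero = fraction R S \<zero>\<^bsub>R\<^esub> \<one>\<^bsub>R\<^esub>,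
      add = (\<lambda>U V. \<Union>(a, s)\<in>U. \<Union>(b, t)\<in>V.
        fraction R S (a \<otimes>\<^bsub>R\<^esub> t \<oplus>\<^bsub>R\<^esub> b \<otimes>\<^bsub>R\<^esub> s) (s \<otimes>\<^bsub>R\<^esub> t))\<rparr>"

definition cohen_macaulay :: "('a, 'b) ring_scheme \<Rightarrow> bool" where
  "cohen_macaulay R \<longleftrightarrow>
     cring R \<and> noetherian_ring R \<and>
     (\<forall>M. maximalideal M R \<longrightarrow> cohen_macaulay_local (localization R (carrier R - M)))"

section \<open>Polynomials in finitely many variables\<close>

text \<open>Monomials are exponent vectors; the type \<open>'v\<close> indexes the variables.\<close>

type_synonym ('v, 'k) mpoly = "('v \<Rightarrow>\<^sub>0 nat) \<Rightarrow>\<^sub>0 'k"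

definition pvar :: "'v \<Rightarrow> ('v, 'k::comm_ring_1) mpoly" where
  "pvar i = Poly_Mapping.single (Poly_Mapping.single i 1) 1"

abbreviation mpoly_ring :: "('v, 'k::comm_ring_1) mpoly ring" where
  "mpoly_ring \<equiv> ring_of_type_algebra"

definition minimally_generates :: "('v, 'k::comm_ring_1) mpoly set \<Rightarrow> ('v, 'k) mpoly set \<Rightarrow> bool" where
  "minimally_generates G I \<longleftrightarrow>
     Idl\<^bsub>mpoly_ring\<^esub> G = I \<and> (\<forall>H. H \<subset> G \<longrightarrow> Idl\<^bsub>mpoly_ring\<^esub> H \<noteq> I)"

definition total_degree :: "('v::finite \<Rightarrow>\<^sub>0 nat) \<Rightarrow> nat" where
  "total_degree m = (\<Sum>i\<in>UNIV. Poly_Mapping.lookup m i)"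

text \<open>The homogeneous summand \<open>f\<^sub>*\<close> of least degree; it is \<open>0\<close> for \<open>f = 0\<close>.\<close>

definition least_form :: "('v::finite, 'k::comm_ring_1) mpoly \<Rightarrow> ('v, 'k) mpoly" where
  "least_form f =
     (\<Sum>m\<in>{m \<in> Poly_Mapping.keys f. total_degree m = Min (total_degree ` Poly_Mapping.keys f)}.
        Poly_Mapping.single m (Poly_Mapping.lookup f m))"

definition tangent_ideal :: "('v::finite, 'k::comm_ring_1) mpoly set \<Rightarrow> ('v, 'k) mpoly set" where
  "tangent_ideal I = Idl\<^bsub>mpoly_ring\<^esub> (least_form ` I)"

definition cohen_macaulay_tangent_cone :: "('v::finite, 'k::comm_ring_1) mpoly set \<Rightarrow> bool" where
  "cohen_macaulay_tangent_cone I \<longleftrightarrow> cohen_macaulay (mpoly_ring Quot tangent_ideal I)"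

section \<open>Monomial curves\<close>

text \<open>The substitution homomorphism \<open>x\<^sub>i \<mapsto> t\<^bsup>n i\<^esup>\<close> from \<open>K[x]\<close> to \<open>K[t]\<close>.\<close>

definition curve_map :: "('v::finite \<Rightarrow> nat) \<Rightarrow> ('v, 'k::comm_ring_1) mpoly \<Rightarrow> 'k poly" where
  "curve_map n f =
     (\<Sum>m\<in>Poly_Mapping.keys f. Polynomial.smult (Poly_Mapping.lookup f m)
        (\<Prod>i\<in>UNIV. (Polynomial.monom 1 (n i)) ^ Poly_Mapping.lookup m i))"

definition curve_ideal :: "('v::finite \<Rightarrow> nat) \<Rightarrow> ('v, 'k::comm_ring_1) mpoly set" where
  "curve_ideal n = {f. curve_map n f = 0}"

text \<open>
  The ideal of a curve in affine space with coordinates indexed by \<open>'v\<close> has height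
  \<open>CARD('v) - 1\<close>, so the curve is a complete intersection iff that many polynomials generate
  its ideal.
\<close>

definition complete_intersection_curve :: "('v::finite, 'k::comm_ring_1) mpoly set \<Rightarrow> bool" where
  "complete_intersection_curve I \<longleftrightarrow>
     (\<exists>G. finite G \<and> card G = CARD('v) - 1 \<and> Idl\<^bsub>mpoly_ring\<^esub> G = I)"

definition generated_semigroup :: "('v::finite \<Rightarrow> nat) \<Rightarrow> nat set" where
  "generated_semigroup n = {\<Sum>i\<in>UNIV. g i * n i | g :: 'v \<Rightarrow> nat. True}"

text \<open>The Frobenius number is taken in the integers, since it is \<open>-1\<close> for the semigroup of all
  natural numbers.\<close>

definition frobenius_number :: "nat set \<Rightarrow> int \<Rightarrow> bool" where
  "frobenius_number S F \<longleftrightarrow> F \<notin> int ` S \<and> (\<forall>z>F. z \<in> int ` S)"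

definition symmetric_semigroup :: "nat set \<Rightarrow> bool" where
  "symmetric_semigroup S \<longleftrightarrow>
     (\<exists>F. frobenius_number S F \<and> (\<forall>z::int. z \<in> int ` S \<longleftrightarrow> F - z \<notin> int ` S))"

definition gorenstein_curve :: "('v::finite \<Rightarrow> nat) \<Rightarrow> bool" where
  "gorenstein_curve n \<longleftrightarrow> symmetric_semigroup (generated_semigroup n)"

end

theory Submission
  imports Defs
begin

text \<open>
  Give a monomial the weight \<open>s\<close> if it is mapped to \<open>t\<^sup>s\<close>, and let \<open>D s\<close> be the largest degree of a
  monomial of weight \<open>s\<close>. The coordinate ring of the tangent cone is the associated graded ring of
  the semigroup ring \<open>K[t\<^sup>s]\<close>. It has one basis element \<open>e s\<close> for each \<open>s\<close> in the semigroup, in degree \<open>D s\<close>,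
  and \<open>x\<^sub>i\<close> times \<open>e s\<close> is \<open>e (s + n i)\<close> if \<open>D (s + n i) = D s + 1\<close>, and \<open>0\<close> otherwise. In
  terms of polynomials: \<open>f\<close> lies in the tangent ideal iff for every \<open>s\<close> the coefficients of its
  monomials of weight \<open>s\<close> and degree \<open>D s\<close> add up to \<open>0\<close> (\<open>tangent_ideal_curve_ideal\<close>). So \<open>x\<^sub>1\<close> is a
  nonzerodivisor iff \<open>D (s + n 1) = D s + 1\<close> for all \<open>s\<close> (\<open>pvar_regular_iff\<close>).

  The tangent cone is Cohen-Macaulay iff \<open>x\<^sub>1\<close> is a nonzerodivisor
  (\<open>cohen_macaulay_iff_pvar_regular\<close>). Since \<open>n 1\<close> is smallest, the other variables are nilpotent on
  the tangent cone, and its reduction is the line with coordinate \<open>x\<^sub>1\<close>. All localizations at maximal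
  ideals have dimension one, and to be Cohen-Macaulay they need a nonzerodivisor in their maximal ideal
  (\<open>cohen_macaulay_iff_locally_regular_element\<close>). If \<open>x\<^sub>1\<close> is regular, every maximal ideal
  contains a regular element, namely \<open>x\<^sub>1\<close> or some \<open>1 - x\<^sub>1 b\<close>. Conversely, let \<open>a\<close> be regular at the
  origin. Up to a unit of the local ring, a power of \<open>a\<close> is a multiple of \<open>x\<^sub>1\<close>, so \<open>x\<^sub>1\<close> is regular at the
  origin, and therefore everywhere, by the grading by weight.

  The condition on \<open>D\<close> is decided by the generators. Monomials of equal weight are connected by
  moves that replace one monomial of a generator by the other
  (\<open>coeff_sum_ideal_zero\<close>). The powers \<open>x\<^sub>3\<^bsup>a23\<^esup>\<close> and \<open>x\<^sub>4\<^bsup>a34\<^esup>\<close> allow no move, so they have maximal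
  degree; if multiplication by \<open>x\<^sub>1\<close> preserves maximal degrees, then the second monomials of \<open>f\<^sub>2\<close> and \<open>f\<^sub>3\<close>
  have maximal degree too, which gives the two inequalities (\<open>exponents_le_of_regular\<close>). If the two
  inequalities hold, then together with the ones that follow from \<open>n 1 < n 2 < n 3 < n 4\<close> they say that
  the moves towards multiples of \<open>x\<^sub>1\<close> do not lower the degree, and \<open>x\<^sub>1\<close> can be divided out of a monomial
  of maximal degree whenever the weight permits (\<open>divide_out_x1\<close>).
\<close>

section \<open>Localization\<close>

text \<open>
  Every \<open>y\<close> is associated to the image of some \<open>a\<close>, so an ideal of \<open>L\<close> is generated by the
  images of generators of its preimage. In this form the lemma covers quotients (\<open>\<phi>\<close> is onto)
  and localizations (each fraction is a unit multiple of its numerator) at once.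
\<close>

lemma noetherian_ring_transfer:
  assumes "noetherian_ring R" "cring L" "\<phi> \<in> ring_hom R L"
    and gen: "\<And>y. y \<in> carrier L \<Longrightarrow>
      \<exists>a\<in>carrier R. \<exists>x\<in>carrier L. \<exists>z\<in>carrier L. y = x \<otimes>\<^bsub>L\<^esub> \<phi> a \<and> \<phi> a = z \<otimes>\<^bsub>L\<^esub> y"
  shows "noetherian_ring L"
proof -
  interpret R: noetherian_ring R by fact
  interpret L: cring L by fact
  interpret h: ring_hom_ring R L \<phi>
    by (rule ring_hom_ringI2) (use assms R.ring_axioms L.ring_axioms in auto)
  show ?thesis
  proof (rule L.noetherian_ringI)
    fix Q assume Q: "ideal Q L"
    then interpret Q: ideal Q L .
    define Q' where "Q' = {a \<in> carrier R. \<phi> a \<in> Q}"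
    have "ideal Q' R"
      unfolding Q'_def by (rule h.ideal_vimage[OF Q])
    then obtain A where A: "A \<subseteq> carrier R" "finite A" "Q' = Idl\<^bsub>R\<^esub> A"
      using R.finetely_gen by blast
    have AQ: "\<phi> ` A \<subseteq> Q"
      using R.genideal_self[OF A(1)] A(3) by (auto simp: Q'_def)
    have sub: "\<phi> ` A \<subseteq> carrier L"
      using A by auto
    interpret G: ideal "Idl\<^bsub>L\<^esub> (\<phi> ` A)" L
      using L.genideal_ideal[OF sub] .
    have "Idl\<^bsub>R\<^esub> A \<subseteq> {a \<in> carrier R. \<phi> a \<in> Idl\<^bsub>L\<^esub> (\<phi> ` A)}"
    proof (rule R.genideal_minimal)
      show "ideal {a \<in> carrier R. \<phi> a \<in> Idl\<^bsub>L\<^esub> (\<phi> ` A)} R"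
        by (rule h.ideal_vimage[OF L.genideal_ideal[OF sub]])
      show "A \<subseteq> {a \<in> carrier R. \<phi> a \<in> Idl\<^bsub>L\<^esub> (\<phi> ` A)}"
        using A(1) L.genideal_self[OF sub] by auto
    qed
    then have *: "\<phi> a \<in> Idl\<^bsub>L\<^esub> (\<phi> ` A)" if "a \<in> Q'" for a
      using that A(3) by auto
    have "Q \<subseteq> Idl\<^bsub>L\<^esub> (\<phi> ` A)"
    proof
      fix y assume y: "y \<in> Q"
      then have "y \<in> carrier L" by auto
      from gen[OF this] obtain a x z where axz: "a \<in> carrier R" "x \<in> carrier L" "z \<in> carrier L"
        "y = x \<otimes>\<^bsub>L\<^esub> \<phi> a" "\<phi> a = z \<otimes>\<^bsub>L\<^esub> y" by blast
      have "a \<in> Q'"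
        using axz y Q.I_l_closed by (auto simp: Q'_def)
      with * show "y \<in> Idl\<^bsub>L\<^esub> (\<phi> ` A)"
        using axz(2,4) G.I_l_closed by auto
    qed
    moreover have "Idl\<^bsub>L\<^esub> (\<phi> ` A) \<subseteq> Q"
      by (rule L.genideal_minimal[OF Q AQ])
    ultimately show "\<exists>A\<subseteq>carrier L. finite A \<and> Q = Idl\<^bsub>L\<^esub> A"
      using sub A(2) by blast
  qed
qed

locale mult_system = cring R for R (structure) +
  fixes S
  assumes S_carrier: "S \<subseteq> carrier R"
    and S_one: "\<one> \<in> S"
    and S_mult: "\<lbrakk>s \<in> S; t \<in> S\<rbrakk> \<Longrightarrow> s \<otimes> t \<in> S"
begin

abbreviation L where "L \<equiv> localization R S"
abbreviation fr where "fr \<equiv> fraction R S"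

lemma S_closed [simp]: "s \<in> S \<Longrightarrow> s \<in> carrier R"
  using S_carrier by auto

declare S_one [simp] S_mult [simp]

lemma S_pow: "s \<in> S \<Longrightarrow> s [^] (k::nat) \<in> S"
  by (induct k) auto

text \<open>
  The factor \<open>u\<close> in the relation is what makes it transitive in the presence of zero divisors: a
  chain with factors \<open>u\<close>, \<open>v\<close> through the denominator \<open>t\<close> has the factor \<open>u v t\<close>.
\<close>

lemma equiv_fraction_rel: "equiv (carrier R \<times> S) (fraction_rel R S)"
proof (rule equivI)
  show "fraction_rel R S \<subseteq> (carrier R \<times> S) \<times> (carrier R \<times> S)"
    by (auto simp: fraction_rel_def)
  show "refl_on (carrier R \<times> S) (fraction_rel R S)"
    by (auto simp: refl_on_def fraction_rel_def intro!: bexI[of _ \<one>])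
  show "sym (fraction_rel R S)"
    by (auto simp: sym_def fraction_rel_def intro: sym)
  show "trans (fraction_rel R S)"
  proof (rule transI)
    fix x y z assume xy: "(x, y) \<in> fraction_rel R S" and yz: "(y, z) \<in> fraction_rel R S"
    obtain a s b t c r where xyz: "x = (a, s)" "y = (b, t)" "z = (c, r)"
      by (metis surj_pair)
    from xy yz obtain u v
      where uv: "u \<in> S" "v \<in> S" "u \<otimes> (a \<otimes> t) = u \<otimes> (b \<otimes> s)" "v \<otimes> (b \<otimes> r) = v \<otimes> (c \<otimes> t)"
        and car: "a \<in> carrier R" "b \<in> carrier R" "c \<in> carrier R" "s \<in> S" "t \<in> S" "r \<in> S"
      by (auto simp: xyz fraction_rel_def)
    have S': "s \<in> carrier R" "t \<in> carrier R" "r \<in> carrier R" "u \<in> carrier R" "v \<in> carrier R"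
      using uv car by auto
    have "(u \<otimes> v \<otimes> t) \<otimes> (a \<otimes> r) = v \<otimes> r \<otimes> (u \<otimes> (a \<otimes> t))"
      using S' car by (simp add: m_ac)
    also have "\<dots> = u \<otimes> s \<otimes> (v \<otimes> (b \<otimes> r))"
      unfolding uv(3) using S' car by (simp add: m_ac)
    also have "\<dots> = (u \<otimes> v \<otimes> t) \<otimes> (c \<otimes> s)"
      unfolding uv(4) using S' car by (simp add: m_ac)
    finally show "(x, z) \<in> fraction_rel R S"
      using uv car by (auto simp: xyz fraction_rel_def intro!: bexI[of _ "u \<otimes> v \<otimes> t"])
  qed
qed

lemma fraction_eq_iff:
  assumes "a \<in> carrier R" "b \<in> carrier R" "s \<in> S" "t \<in> S"
  shows "fr a s = fr b t \<longleftrightarrow> (\<exists>u\<in>S. u \<otimes> (a \<otimes> t) = u \<otimes> (b \<otimes> s))"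
  using eq_equiv_class_iff[OF equiv_fraction_rel, of "(a, s)" "(b, t)"] assms
  by (auto simp: fraction_def fraction_rel_def)

lemma fraction_eqI:
  assumes "a \<in> carrier R" "b \<in> carrier R" "s \<in> S" "t \<in> S" "a \<otimes> t = b \<otimes> s"
  shows "fr a s = fr b t"
  using assms by (auto simp: fraction_eq_iff intro!: bexI[of _ \<one>])

lemma fraction_memI: "\<lbrakk>a \<in> carrier R; s \<in> S\<rbrakk> \<Longrightarrow> (a, s) \<in> fr a s"
  using equiv_class_self[OF equiv_fraction_rel] by (auto simp: fraction_def)

lemma fraction_memD:
  assumes "(b, t) \<in> fr a s"
  shows "b \<in> carrier R" "t \<in> S" "a \<in> carrier R" "s \<in> S" "fr b t = fr a s"
proof -
  have *: "((a, s), (b, t)) \<in> fraction_rel R S"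
    using assms by (auto simp: fraction_def)
  then show "b \<in> carrier R" "t \<in> S" "a \<in> carrier R" "s \<in> S"
    by (auto simp: fraction_rel_def)
  show "fr b t = fr a s"
    unfolding fraction_def using equiv_class_eq[OF equiv_fraction_rel *] by simp
qed

lemma carrier_L: "carrier L = {fr a s | a s. a \<in> carrier R \<and> s \<in> S}"
  by (auto simp: localization_def quotient_def fraction_def)

lemma fraction_closed [simp]: "\<lbrakk>a \<in> carrier R; s \<in> S\<rbrakk> \<Longrightarrow> fr a s \<in> carrier L"
  by (auto simp: carrier_L)

lemma fraction_cases:
  assumes "x \<in> carrier L"
  obtains a s where "a \<in> carrier R" "s \<in> S" "x = fr a s"
  using assms by (auto simp: carrier_L)

lemma fraction_mult:
  assumes "a \<in> carrier R" "s \<in> S" "b \<in> carrier R" "t \<in> S"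
  shows "fr a s \<otimes>\<^bsub>L\<^esub> fr b t = fr (a \<otimes> b) (s \<otimes> t)"
proof -
  have *: "fr (a' \<otimes> b') (s' \<otimes> t') = fr (a \<otimes> b) (s \<otimes> t)"
    if "(a', s') \<in> fr a s" "(b', t') \<in> fr b t" for a' s' b' t'
  proof -
    note A = fraction_memD[OF that(1)] and B = fraction_memD[OF that(2)]
    obtain u v where uv: "u \<in> S" "v \<in> S"
      "u \<otimes> (a' \<otimes> s) = u \<otimes> (a \<otimes> s')" "v \<otimes> (b' \<otimes> t) = v \<otimes> (b \<otimes> t')"
      using A B by (auto simp: fraction_eq_iff)
    have "(u \<otimes> v) \<otimes> (a' \<otimes> b' \<otimes> (s \<otimes> t)) = (u \<otimes> (a' \<otimes> s)) \<otimes> (v \<otimes> (b' \<otimes> t))"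
      using A B uv(1,2) by (simp add: m_ac)
    also have "\<dots> = (u \<otimes> v) \<otimes> (a \<otimes> b \<otimes> (s' \<otimes> t'))"
      unfolding uv(3,4) using A B uv(1,2) by (simp add: m_ac)
    finally show ?thesis
      using A B uv(1,2) by (subst fraction_eq_iff) (auto intro!: bexI[of _ "u \<otimes> v"])
  qed
  have inner: "(\<Union>(b', t')\<in>fr b t. fr (a' \<otimes> b') (s' \<otimes> t')) = fr (a \<otimes> b) (s \<otimes> t)"
    if "(a', s') \<in> fr a s" for a' s'
    by (rule UN_constant_eq[OF fraction_memI[OF assms(3,4)]]) (use *[OF that] in auto)
  show ?thesis
    unfolding localization_def monoid.simps
    by (rule UN_constant_eq[OF fraction_memI[OF assms(1,2)]]) (use inner in auto)
qed

lemma fraction_add: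
  assumes "a \<in> carrier R" "s \<in> S" "b \<in> carrier R" "t \<in> S"
  shows "fr a s \<oplus>\<^bsub>L\<^esub> fr b t = fr (a \<otimes> t \<oplus> b \<otimes> s) (s \<otimes> t)"
proof -
  have *: "fr (a' \<otimes> t' \<oplus> b' \<otimes> s') (s' \<otimes> t') = fr (a \<otimes> t \<oplus> b \<otimes> s) (s \<otimes> t)"
    if "(a', s') \<in> fr a s" "(b', t') \<in> fr b t" for a' s' b' t'
  proof -
    note A = fraction_memD[OF that(1)] and B = fraction_memD[OF that(2)]
    obtain u v where uv: "u \<in> S" "v \<in> S"
      "u \<otimes> (a' \<otimes> s) = u \<otimes> (a \<otimes> s')" "v \<otimes> (b' \<otimes> t) = v \<otimes> (b \<otimes> t')"
      using A B by (auto simp: fraction_eq_iff)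
    have car: "u \<in> carrier R" "v \<in> carrier R" "a \<in> carrier R" "b \<in> carrier R" "s \<in> carrier R"
      "t \<in> carrier R" "a' \<in> carrier R" "b' \<in> carrier R" "s' \<in> carrier R" "t' \<in> carrier R"
      using A B uv by auto
    have "(u \<otimes> v) \<otimes> ((a' \<otimes> t' \<oplus> b' \<otimes> s') \<otimes> (s \<otimes> t))
        = (u \<otimes> (a' \<otimes> s)) \<otimes> (v \<otimes> t \<otimes> t') \<oplus> (v \<otimes> (b' \<otimes> t)) \<otimes> (u \<otimes> s \<otimes> s')"
      using car by algebra
    also have "\<dots> = (u \<otimes> v) \<otimes> ((a \<otimes> t \<oplus> b \<otimes> s) \<otimes> (s' \<otimes> t'))"
      unfolding uv(3,4) using car by algebra
    finally show ?thesis
      using A B uv(1,2) by (subst fraction_eq_iff) (auto intro!: bexI[of _ "u \<otimes> v"])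
  qed
  have inner: "(\<Union>(b', t')\<in>fr b t. fr (a' \<otimes> t' \<oplus> b' \<otimes> s') (s' \<otimes> t'))
      = fr (a \<otimes> t \<oplus> b \<otimes> s) (s \<otimes> t)"
    if "(a', s') \<in> fr a s" for a' s'
    by (rule UN_constant_eq[OF fraction_memI[OF assms(3,4)]]) (use *[OF that] in auto)
  show ?thesis
    unfolding localization_def ring.simps monoid.simps
    by (rule UN_constant_eq[OF fraction_memI[OF assms(1,2)]]) (use inner in auto)
qed

lemma zero_L: "\<zero>\<^bsub>L\<^esub> = fr \<zero> \<one>" and one_L: "\<one>\<^bsub>L\<^esub> = fr \<one> \<one>"
  by (simp_all add: localization_def)

lemma fraction_eq_zero_iff:
  assumes "a \<in> carrier R" "s \<in> S"
  shows "fr a s = \<zero>\<^bsub>L\<^esub> \<longleftrightarrow> (\<exists>u\<in>S. u \<otimes> a = \<zero>)"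
  using assms by (auto simp: zero_L fraction_eq_iff)

lemma cring_localization: "cring L"
proof (rule cringI)
  show "abelian_group L"
  proof (rule abelian_groupI)
    fix x y z assume x: "x \<in> carrier L"
    then obtain a s where a: "a \<in> carrier R" "s \<in> S" "x = fr a s" by (rule fraction_cases)
    have "fr (\<ominus> a) s \<oplus>\<^bsub>L\<^esub> x = \<zero>\<^bsub>L\<^esub>"
      using a by (simp add: zero_L fraction_add) (rule fraction_eqI, simp_all add: l_minus l_neg)
    then show "\<exists>y\<in>carrier L. y \<oplus>\<^bsub>L\<^esub> x = \<zero>\<^bsub>L\<^esub>"
      using a by (intro bexI[of _ "fr (\<ominus> a) s"]) auto
    show "\<zero>\<^bsub>L\<^esub> \<oplus>\<^bsub>L\<^esub> x = x"
      using a by (simp add: zero_L fraction_add)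
    assume y: "y \<in> carrier L"
    then obtain b t where b: "b \<in> carrier R" "t \<in> S" "y = fr b t" by (rule fraction_cases)
    have st: "s \<in> carrier R" "t \<in> carrier R" using a b by auto
    show "x \<oplus>\<^bsub>L\<^esub> y \<in> carrier L"
      using a b by (simp add: fraction_add)
    show "x \<oplus>\<^bsub>L\<^esub> y = y \<oplus>\<^bsub>L\<^esub> x"
      using a b by (simp add: fraction_add a_comm m_comm)
    assume z: "z \<in> carrier L"
    then obtain c r where c: "c \<in> carrier R" "r \<in> S" "z = fr c r" by (rule fraction_cases)
    have r: "r \<in> carrier R" using c by auto
    have *: "(a \<otimes> t \<oplus> b \<otimes> s) \<otimes> r \<oplus> c \<otimes> (s \<otimes> t) = a \<otimes> (t \<otimes> r) \<oplus> (b \<otimes> r \<oplus> c \<otimes> t) \<otimes> s"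
      using a(1) b(1) c(1) st r by algebra
    show "x \<oplus>\<^bsub>L\<^esub> y \<oplus>\<^bsub>L\<^esub> z = x \<oplus>\<^bsub>L\<^esub> (y \<oplus>\<^bsub>L\<^esub> z)"
      using a b c by (simp add: fraction_add * m_assoc)
  qed (simp add: zero_L)
  show "comm_monoid L"
  proof (rule comm_monoidI)
    fix x y z assume x: "x \<in> carrier L"
    then obtain a s where a: "a \<in> carrier R" "s \<in> S" "x = fr a s" by (rule fraction_cases)
    show "\<one>\<^bsub>L\<^esub> \<otimes>\<^bsub>L\<^esub> x = x"
      using a by (simp add: one_L fraction_mult)
    assume y: "y \<in> carrier L"
    then obtain b t where b: "b \<in> carrier R" "t \<in> S" "y = fr b t" by (rule fraction_cases)
    show "x \<otimes>\<^bsub>L\<^esub> y \<in> carrier L"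
      using a b by (simp add: fraction_mult)
    show "x \<otimes>\<^bsub>L\<^esub> y = y \<otimes>\<^bsub>L\<^esub> x"
      using a b by (simp add: fraction_mult m_comm)
    assume z: "z \<in> carrier L"
    then obtain c r where c: "c \<in> carrier R" "r \<in> S" "z = fr c r" by (rule fraction_cases)
    show "x \<otimes>\<^bsub>L\<^esub> y \<otimes>\<^bsub>L\<^esub> z = x \<otimes>\<^bsub>L\<^esub> (y \<otimes>\<^bsub>L\<^esub> z)"
      using a b c by (simp add: fraction_mult m_assoc)
  qed (simp add: one_L)
  fix x y z assume "x \<in> carrier L" "y \<in> carrier L" "z \<in> carrier L"
  then obtain a s b t c r where abc: "a \<in> carrier R" "s \<in> S" "x = fr a s"
    "b \<in> carrier R" "t \<in> S" "y = fr b t" "c \<in> carrier R" "r \<in> S" "z = fr c r"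
    by (metis fraction_cases)
  have car: "s \<in> carrier R" "t \<in> carrier R" "r \<in> carrier R" using abc by auto
  have "(a \<otimes> t \<oplus> b \<otimes> s) \<otimes> c \<otimes> ((s \<otimes> r) \<otimes> (t \<otimes> r)) =
     ((a \<otimes> c) \<otimes> (t \<otimes> r) \<oplus> (b \<otimes> c) \<otimes> (s \<otimes> r)) \<otimes> ((s \<otimes> t) \<otimes> r)"
    using abc(1,4,7) car by algebra
  then show "(x \<oplus>\<^bsub>L\<^esub> y) \<otimes>\<^bsub>L\<^esub> z = x \<otimes>\<^bsub>L\<^esub> z \<oplus>\<^bsub>L\<^esub> y \<otimes>\<^bsub>L\<^esub> z"
    using abc by (simp add: fraction_mult fraction_add) (rule fraction_eqI, simp_all)
qed

lemma fraction_pow: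
  assumes "a \<in> carrier R" "s \<in> S"
  shows "fr a s [^]\<^bsub>L\<^esub> (k::nat) = fr (a [^] k) (s [^] k)"
proof -
  interpret L: cring L by (rule cring_localization)
  show ?thesis
    using assms by (induct k) (simp_all add: one_L fraction_mult S_pow)
qed

lemma ring_hom_localization: "(\<lambda>a. fr a \<one>) \<in> ring_hom R L"
  by (rule ring_hom_memI) (auto simp: fraction_mult fraction_add one_L)

definition extended_ideal :: "'a set \<Rightarrow> ('a \<times> 'a) set set" where
  "extended_ideal Q = {fr a s | a s. a \<in> Q \<and> s \<in> S}"

text \<open>
  A prime ideal that avoids \<open>S\<close> can be read off from its extension: cross-multiplying puts the
  numerator times elements of \<open>S\<close> into \<open>Q\<close>, and primality cancels these elements.
\<close>

lemma fraction_in_extended_ideal_iff: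
  assumes Q: "primeideal Q R" "Q \<inter> S = {}" and "a \<in> carrier R" "s \<in> S"
  shows "fr a s \<in> extended_ideal Q \<longleftrightarrow> a \<in> Q"
proof
  interpret Q: primeideal Q R by fact
  assume "fr a s \<in> extended_ideal Q"
  then obtain b t where bt: "b \<in> Q" "t \<in> S" "fr a s = fr b t"
    by (auto simp: extended_ideal_def)
  then obtain u where u: "u \<in> S" "u \<otimes> (a \<otimes> t) = u \<otimes> (b \<otimes> s)"
    using assms by (auto simp: fraction_eq_iff)
  have "u \<otimes> (b \<otimes> s) \<in> Q"
    using bt u assms by (simp add: Q.I_l_closed Q.I_r_closed)
  then have "u \<in> Q \<or> a \<otimes> t \<in> Q"
    using u(2) assms bt(2) u(1) by (intro Q.I_prime) auto
  then have "a \<otimes> t \<in> Q"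
    using Q(2) u(1) by auto
  then have "a \<in> Q \<or> t \<in> Q"
    using assms bt by (intro Q.I_prime) auto
  then show "a \<in> Q"
    using Q(2) bt(2) by auto
qed (use assms in \<open>auto simp: extended_ideal_def\<close>)

lemma primeideal_extended_ideal:
  assumes Q: "primeideal Q R" "Q \<inter> S = {}"
  shows "primeideal (extended_ideal Q) L"
proof -
  interpret Q: primeideal Q R by fact
  interpret L: cring L by (rule cring_localization)
  note iff = fraction_in_extended_ideal_iff[OF Q]
  have sub: "extended_ideal Q \<subseteq> carrier L"
    by (auto simp: extended_ideal_def)
  have add: "x \<oplus>\<^bsub>L\<^esub> y \<in> extended_ideal Q" if "x \<in> extended_ideal Q" "y \<in> extended_ideal Q" for x y
    using that by (auto simp: extended_ideal_def fraction_add) (auto intro!: exI Q.I_r_closed)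
  have mul: "x \<otimes>\<^bsub>L\<^esub> y \<in> extended_ideal Q" if "x \<in> extended_ideal Q" "y \<in> carrier L" for x y
    using that by (auto simp: extended_ideal_def carrier_L fraction_mult) (auto intro!: exI Q.I_r_closed)
  have "ideal (extended_ideal Q) L"
  proof (rule idealI[OF L.ring_axioms L.add.subgroupI])
    show "extended_ideal Q \<noteq> {}"
      using Q.zero_closed S_one unfolding extended_ideal_def by blast
    show "\<ominus>\<^bsub>L\<^esub> x \<in> extended_ideal Q" if "x \<in> extended_ideal Q" for x
    proof -
      have "\<ominus>\<^bsub>L\<^esub> x = x \<otimes>\<^bsub>L\<^esub> (\<ominus>\<^bsub>L\<^esub> \<one>\<^bsub>L\<^esub>)"
        using that sub by (auto simp: L.r_minus)
      then show ?thesis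
        using mul[OF that] by simp
    qed
    fix x y assume "x \<in> extended_ideal Q" "y \<in> carrier L"
    then show "x \<otimes>\<^bsub>L\<^esub> y \<in> extended_ideal Q" "y \<otimes>\<^bsub>L\<^esub> x \<in> extended_ideal Q"
      using mul[of x y] sub by (auto simp: L.m_comm[of y x])
  qed (use sub add in auto)
  then show ?thesis
  proof (rule primeidealI[OF _ cring_localization])
    have "\<one>\<^bsub>L\<^esub> \<notin> extended_ideal Q"
      using Q(2) iff[of \<one> \<one>] by (auto simp: one_L)
    then show "carrier L \<noteq> extended_ideal Q"
      using L.one_closed by auto
    fix x y assume xy: "x \<in> carrier L" "y \<in> carrier L" "x \<otimes>\<^bsub>L\<^esub> y \<in> extended_ideal Q"
    then obtain a s b t where ab: "a \<in> carrier R" "s \<in> S" "x = fr a s"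
      "b \<in> carrier R" "t \<in> S" "y = fr b t"
      by (metis fraction_cases)
    then have "a \<otimes> b \<in> Q"
      using xy(3) by (simp add: fraction_mult iff)
    then have "a \<in> Q \<or> b \<in> Q"
      using ab by (intro Q.I_prime) auto
    then show "x \<in> extended_ideal Q \<or> y \<in> extended_ideal Q"
      using ab by (simp add: iff)
  qed
qed

lemma noetherian_localization:
  assumes "noetherian_ring R"
  shows "noetherian_ring L"
proof (rule noetherian_ring_transfer[OF assms cring_localization ring_hom_localization])
  fix y assume "y \<in> carrier L"
  then obtain a s where a: "a \<in> carrier R" "s \<in> S" "y = fr a s" by (rule fraction_cases)
  have "y = fr \<one> s \<otimes>\<^bsub>L\<^esub> fr a \<one>"
    using a by (simp add: fraction_mult)
  moreover have "fr a \<one> = fr s \<one> \<otimes>\<^bsub>L\<^esub> y"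
    using a by (simp add: fraction_mult) (rule fraction_eqI, simp_all add: m_comm)
  ultimately show "\<exists>a\<in>carrier R. \<exists>x\<in>carrier L. \<exists>z\<in>carrier L. y = x \<otimes>\<^bsub>L\<^esub> fr a \<one> \<and> fr a \<one> = z \<otimes>\<^bsub>L\<^esub> y"
    using a by (metis S_closed S_one fraction_closed one_closed)
qed

end

locale localization_at_maximal = cring R + M: maximalideal M R for M and R (structure)

sublocale localization_at_maximal \<subseteq> mult_system R "carrier R - M"
proof (unfold_locales)
  interpret P: primeideal M R
    using maximalideal_prime[OF M.maximalideal_axioms] .
  show "\<one> \<in> carrier R - M"
    using M.I_notcarr M.one_imp_carrier by auto
  show "s \<otimes> t \<in> carrier R - M" if "s \<in> carrier R - M" "t \<in> carrier R - M" for s t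
    using that P.I_prime by auto
qed auto

context localization_at_maximal
begin

lemma primeideal_M: "primeideal M R"
  using maximalideal_prime[OF M.maximalideal_axioms] .

text \<open>
  Together with the primality of the extension of \<open>M\<close>, this says that the localization is local.
\<close>

lemma fraction_Units:
  assumes "x \<in> carrier L - extended_ideal M"
  shows "x \<in> Units L"
proof -
  from assms obtain a s where a: "a \<in> carrier R" "s \<in> carrier R - M" "x = fr a s"
    by (auto elim: fraction_cases)
  then have aM: "a \<in> carrier R - M"
    using assms fraction_in_extended_ideal_iff[OF primeideal_M] by auto
  have same: "fr (a \<otimes> s) (a \<otimes> s) = fr \<one> \<one>"
    using a aM S_one S_mult[OF aM a(2)] by (intro fraction_eqI) auto
  have "fr s a \<otimes>\<^bsub>L\<^esub> x = \<one>\<^bsub>L\<^esub>" "x \<otimes>\<^bsub>L\<^esub> fr s a = \<one>\<^bsub>L\<^esub>"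
    using a aM same by (simp_all add: fraction_mult one_L m_comm[of s a])
  moreover have "fr s a \<in> carrier L" "x \<in> carrier L"
    using a aM by auto
  ultimately show ?thesis
    unfolding Units_def by blast
qed

end

section \<open>Cohen-Macaulay rings of dimension one\<close>

lemma (in primeideal) pow_in_prime:
  assumes "a \<in> carrier R" "a [^] (k::nat) \<in> I"
  shows "a \<in> I"
  using assms(2)
proof (induct k)
  case 0
  then show ?case using I_notcarr one_imp_carrier by auto
next
  case (Suc k)
  then show ?case using assms(1) I_prime[of "a [^] k" a] by auto
qed

text \<open>
  If \<open>a\<close> is a nonzerodivisor modulo \<open>I\<close>, then a power of \<open>a\<close> in \<open>I\<close> can be cancelled down to
  \<open>1 = a\<^sup>0\<close>. A regular sequence therefore never contains an element that is nilpotent modulo its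
  predecessors.
\<close>

lemma (in ring) regular_pow_imp_one:
  assumes "ideal I R" "a \<in> carrier R" "a [^] (k::nat) \<in> I"
    and reg: "\<And>y. y \<in> carrier R \<Longrightarrow> a \<otimes> y \<in> I \<Longrightarrow> y \<in> I"
  shows "\<one> \<in> I"
  using assms(3)
proof (induct k)
  case (Suc k)
  have "a \<otimes> a [^] k = a [^] Suc k"
    using assms(2) by (metis nat_pow_Suc2)
  then show ?case using Suc reg[of "a [^] k"] assms(2) by auto
qed auto

lemma (in ring) genideal_empty: "Idl {} = {\<zero>}"
proof
  show "Idl {} \<subseteq> {\<zero>}"
    by (rule genideal_minimal[OF zeroideal]) simp
  interpret I: ideal "Idl {}" R
    by (rule genideal_ideal) simp
  show "{\<zero>} \<subseteq> Idl {}"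
    using I.zero_closed by simp
qed

text \<open>
  By the hypothesis on \<open>f\<close> and \<open>h\<close>, a prime ideal that contains some \<open>f\<close> outside \<open>P\<close> contains \<open>M\<close>.
  Hence \<open>P\<close> and \<open>M\<close> are the only primes, and the dimension is one. The depth is at most one:
  the first element \<open>a\<close> of a regular sequence is not nilpotent, so it lies outside \<open>P\<close>, and then
  the second one has a power in \<open>(a)\<close>. What remains is whether a regular sequence of length one
  exists.
\<close>

lemma cohen_macaulay_local_iff_regular_element:
  fixes L (structure)
  assumes "cring L" "noetherian_ring L"
    and M: "primeideal M L" and units: "\<And>x. x \<in> carrier L - M \<Longrightarrow> x \<in> Units L"
    and P: "primeideal P L" and nil: "\<And>p. p \<in> P \<Longrightarrow> \<exists>k::nat. p [^] k = \<zero>"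
    and ne: "M \<noteq> P"
    and D: "\<And>f h. f \<in> carrier L - P \<Longrightarrow> h \<in> M \<Longrightarrow> \<exists>k::nat. \<exists>w\<in>carrier L. h [^] k = f \<otimes> w"
  shows "cohen_macaulay_local L \<longleftrightarrow> (\<exists>a\<in>M. \<forall>y\<in>carrier L. a \<otimes> y = \<zero> \<longrightarrow> y = \<zero>)"
proof -
  interpret cring L by fact
  interpret M: primeideal M L by fact
  interpret P: primeideal P L by fact
  have sub_M: "Q \<subseteq> M" if "ideal Q L" "Q \<noteq> carrier L" for Q
  proof -
    interpret Q: ideal Q L by fact
    have "x \<in> M" if "x \<in> Q" for x
    proof (rule ccontr)
      assume "x \<notin> M"
      then have x: "x \<in> Units L" using units that by auto
      then have "inv x \<otimes> x \<in> Q"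
        using that by (intro Q.I_l_closed) auto
      then show False
        using x Q.one_imp_carrier \<open>Q \<noteq> carrier L\<close> by simp
    qed
    then show ?thesis by auto
  qed
  have P_sub: "P \<subseteq> Q" if "primeideal Q L" for Q
  proof
    interpret Q: primeideal Q L by fact
    fix p assume p: "p \<in> P"
    then obtain k :: nat where "p [^] k = \<zero>" using nil by blast
    then show "p \<in> Q" using p Q.pow_in_prime[of p k] by auto
  qed
  have PM: "P \<subset> M"
    using P_sub[OF M] ne by auto
  have max: "maximalideal M L"
  proof (rule maximalidealI[OF M.is_ideal M.I_notcarr])
    fix J assume "ideal J L" "M \<subseteq> J"
    then show "J = M \<or> J = carrier L" using sub_M[of J] by auto
  qed
  have uniq: "N = M" if "maximalideal N L" for N
  proof -
    interpret N: maximalideal N L by fact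
    show ?thesis
      using sub_M[OF N.is_ideal] N.I_notcarr N.I_maximal[OF M.is_ideal] M.I_notcarr M.a_subset by auto
  qed
  have local: "noetherian_local_ring L"
    unfolding noetherian_local_ring_def using assms(1,2) max uniq by blast
  have the_M: "(THE M. maximalideal M L) = M"
    using max uniq by (rule the_equality)
  have dim: "krull_dim L = 1"
    unfolding krull_dim_def
  proof (rule antisym[OF Sup_least Sup_upper])
    fix x assume "x \<in> {enat d |d. \<exists>P::nat \<Rightarrow> 'a set. (\<forall>i\<le>d. primeideal (P i) L) \<and> (\<forall>i<d. P i \<subset> P (Suc i))}"
    then obtain d and Q :: "nat \<Rightarrow> 'a set" where d: "x = enat d"
      and Q': "(\<forall>i\<le>d. primeideal (Q i) L) \<and> (\<forall>i<d. Q i \<subset> Q (Suc i))" by blast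
    have Q: "primeideal (Q i) L" if "i \<le> d" for i using Q' that by simp
    have Q_less: "Q i \<subset> Q (Suc i)" if "i < d" for i using Q' that by simp
    have "d \<le> 1"
    proof (rule ccontr)
      assume "\<not> d \<le> 1"
      then have d2: "0 < d" "1 < d" by auto
      interpret Q1: primeideal "Q 1" L using Q d2 by auto
      interpret Q2: primeideal "Q (Suc 1)" L using Q[of "Suc 1"] d2 by linarith
      obtain f where f: "f \<in> Q 1" "f \<notin> Q 0" using Q_less[OF d2(1)] by auto
      then have fP: "f \<in> carrier L - P" using P_sub[OF Q[of 0]] by auto
      have "M \<subseteq> Q 1"
      proof
        fix h assume h: "h \<in> M"
        then obtain k :: nat and w where "w \<in> carrier L" "h [^] k = f \<otimes> w" using D[OF fP] by blast
        then show "h \<in> Q 1" using f h Q1.pow_in_prime[of h k] Q1.I_r_closed by auto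
      qed
      moreover have "Q (Suc 1) \<subseteq> M" by (rule sub_M[OF Q2.is_ideal]) (use Q2.I_notcarr in auto)
      ultimately show False using Q_less[OF d2(2)] by auto
    qed
    then show "x \<le> 1" by (simp add: d one_enat_def)
  next
    have "\<exists>Q::nat \<Rightarrow> 'a set. (\<forall>i\<le>1. primeideal (Q i) L) \<and> (\<forall>i<1. Q i \<subset> Q (Suc i))"
      using PM M P by (intro exI[of _ "\<lambda>i. if i = 0 then P else M"]) auto
    then show "1 \<in> {enat d |d. \<exists>P::nat \<Rightarrow> 'a set. (\<forall>i\<le>d. primeideal (P i) L) \<and> (\<forall>i<d. P i \<subset> P (Suc i))}"
      unfolding one_enat_def by blast
  qed
  have len: "length xs \<le> 1" if xs: "set xs \<subseteq> M" "regular_sequence L xs" for xs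
  proof (rule ccontr)
    assume "\<not> length xs \<le> 1"
    then obtain a b as where ab: "xs = a # b # as"
      by (cases xs; cases "tl xs") auto
    have car: "a \<in> carrier L" "b \<in> carrier L" "a \<in> M" "b \<in> M" using xs ab by auto
    have reg: "\<And>i y. i < length xs \<Longrightarrow> y \<in> carrier L \<Longrightarrow> xs ! i \<otimes> y \<in> Idl (set (take i xs)) \<Longrightarrow> y \<in> Idl (set (take i xs))"
      using xs(2) unfolding regular_sequence_def by blast
    have reg_a: "y \<in> {\<zero>}" if "y \<in> carrier L" "a \<otimes> y \<in> {\<zero>}" for y
      using reg[of 0 y] that by (simp add: ab genideal_empty)
    have reg_b: "y \<in> Idl {a}" if "y \<in> carrier L" "b \<otimes> y \<in> Idl {a}" for y
      using reg[of 1 y] that by (simp add: ab)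
    interpret A: ideal "Idl {a}" L using car by (intro genideal_ideal) auto
    have aP: "a \<notin> P"
    proof
      assume "a \<in> P"
      then obtain k :: nat where "a [^] k \<in> {\<zero>}" using nil by blast
      from regular_pow_imp_one[OF zeroideal car(1) this reg_a] show False
        using M.I_notcarr M.one_imp_carrier by (metis M.zero_closed singletonD)
    qed
    then obtain k :: nat and w where kw: "w \<in> carrier L" "b [^] k = a \<otimes> w"
      using D[of a b] car by blast
    have "a \<in> Idl {a}" using car by (intro genideal_self') auto
    then have "b [^] k \<in> Idl {a}" unfolding kw(2) using kw(1) by (rule A.I_r_closed)
    from regular_pow_imp_one[OF A.is_ideal car(2) this reg_b] have "\<one> \<in> Idl {a}" .
    moreover have "Idl {a} \<subseteq> M" using car by (intro genideal_minimal[OF M.is_ideal]) auto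
    ultimately show False using M.I_notcarr M.one_imp_carrier by auto
  qed
  have depth_le: "depth M L \<le> 1"
    unfolding depth_def by (rule Sup_least) (use len in \<open>auto simp: one_enat_def\<close>)
  have "depth M L = 1 \<longleftrightarrow> (\<exists>a\<in>M. \<forall>y\<in>carrier L. a \<otimes> y = \<zero> \<longrightarrow> y = \<zero>)"
  proof
    assume 1: "depth M L = 1"
    have "\<exists>xs. set xs \<subseteq> M \<and> regular_sequence L xs \<and> length xs \<noteq> 0"
    proof (rule ccontr)
      assume "\<not> ?thesis"
      then have "depth M L \<le> 0"
        unfolding depth_def by (intro Sup_least) (auto simp: zero_enat_def)
      then show False using 1 by simp
    qed
    then obtain a as where a: "set (a # as) \<subseteq> M" "regular_sequence L (a # as)"
      by (metis length_0_conv list.exhaust)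
    then have "\<forall>y\<in>carrier L. a \<otimes> y \<in> Idl {} \<longrightarrow> y \<in> Idl {}"
      unfolding regular_sequence_def by (auto dest!: spec[of _ 0])
    then show "\<exists>a\<in>M. \<forall>y\<in>carrier L. a \<otimes> y = \<zero> \<longrightarrow> y = \<zero>"
      using a(1) by (auto simp: genideal_empty)
  next
    assume "\<exists>a\<in>M. \<forall>y\<in>carrier L. a \<otimes> y = \<zero> \<longrightarrow> y = \<zero>"
    then obtain a where a: "a \<in> M" "\<forall>y\<in>carrier L. a \<otimes> y = \<zero> \<longrightarrow> y = \<zero>" by blast
    have "Idl {a} \<subseteq> M" using a by (intro genideal_minimal[OF M.is_ideal]) auto
    then have "Idl {a} \<noteq> carrier L" using M.I_notcarr M.a_subset by auto
    then have "regular_sequence L [a]"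
      using a unfolding regular_sequence_def by (auto simp: genideal_empty)
    then have "enat (length [a]) \<le> depth M L"
      unfolding depth_def using a(1) by (intro Sup_upper) (auto intro!: exI[of _ "[a]"])
    then show "depth M L = 1" using depth_le by (simp add: one_enat_def)
  qed
  then show ?thesis
    unfolding cohen_macaulay_local_def the_M dim using local by simp
qed

text \<open>
  The previous criterion, applied at every maximal ideal and translated from fractions to
  numerators. The factor \<open>u\<close> in the last hypothesis becomes a unit in the localization.
\<close>

theorem cohen_macaulay_iff_locally_regular_element:
  fixes R (structure)
  assumes "cring R" "noetherian_ring R"
    and P: "primeideal P R" and nil: "\<And>p. p \<in> P \<Longrightarrow> \<exists>k::nat. p [^] k = \<zero>"
    and ne: "\<not> maximalideal P R"
    and D: "\<And>M f h. maximalideal M R \<Longrightarrow> f \<in> carrier R - P \<Longrightarrow> h \<in> M \<Longrightarrow>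
      \<exists>k::nat. \<exists>u\<in>carrier R - M. \<exists>w\<in>carrier R. h [^] k \<otimes> u = f \<otimes> w"
  shows "cohen_macaulay R \<longleftrightarrow> (\<forall>M. maximalideal M R \<longrightarrow>
    (\<exists>a\<in>M. \<forall>y\<in>carrier R. (\<exists>u\<in>carrier R - M. u \<otimes> (a \<otimes> y) = \<zero>) \<longrightarrow> (\<exists>u\<in>carrier R - M. u \<otimes> y = \<zero>)))"
proof -
  interpret cring R by fact
  interpret P: primeideal P R by fact
  have "cohen_macaulay_local (localization R (carrier R - M)) \<longleftrightarrow>
    (\<exists>a\<in>M. \<forall>y\<in>carrier R. (\<exists>u\<in>carrier R - M. u \<otimes> (a \<otimes> y) = \<zero>) \<longrightarrow> (\<exists>u\<in>carrier R - M. u \<otimes> y = \<zero>))"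
    (is "_ \<longleftrightarrow> ?reg") if M: "maximalideal M R" for M
  proof -
    interpret M: maximalideal M R by fact
    interpret localization_at_maximal M R ..
    interpret L: cring L by (rule cring_localization)
    interpret MP: primeideal M R by (rule primeideal_M)
    have "P \<subseteq> M"
    proof
      fix p assume p: "p \<in> P"
      then obtain k :: nat where "p [^] k = \<zero>" using nil by blast
      then show "p \<in> M" using p MP.pow_in_prime[of p k] by auto
    qed
    then have disj: "P \<inter> (carrier R - M) = {}" "M \<inter> (carrier R - M) = {}" by auto
    note inP = fraction_in_extended_ideal_iff[OF P disj(1)] and inM = fraction_in_extended_ideal_iff[OF primeideal_M disj(2)]
    have "M \<noteq> P" using ne M by metis
    then obtain z where z: "z \<in> M" "z \<notin> P" using \<open>P \<subseteq> M\<close> by auto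
    have "cohen_macaulay_local L \<longleftrightarrow> (\<exists>x\<in>extended_ideal M. \<forall>y\<in>carrier L. x \<otimes>\<^bsub>L\<^esub> y = \<zero>\<^bsub>L\<^esub> \<longrightarrow> y = \<zero>\<^bsub>L\<^esub>)"
    proof (rule cohen_macaulay_local_iff_regular_element)
      show "cring L" by (rule cring_localization)
      show "noetherian_ring L" by (rule noetherian_localization) fact
      show "primeideal (extended_ideal M) L" "primeideal (extended_ideal P) L"
        by (intro primeideal_extended_ideal disj primeideal_M P)+
      show "x \<in> Units L" if "x \<in> carrier L - extended_ideal M" for x
        by (rule fraction_Units) fact
      show "\<exists>k::nat. p [^]\<^bsub>L\<^esub> k = \<zero>\<^bsub>L\<^esub>" if p: "p \<in> extended_ideal P" for p
      proof -
        obtain a s where a: "a \<in> P" "s \<in> carrier R - M" "p = fr a s" using p by (auto simp: extended_ideal_def)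
        then obtain k :: nat where k: "a [^] k = \<zero>" using nil by blast
        have "p [^]\<^bsub>L\<^esub> k = fr \<zero> (s [^] k)"
          using a k fraction_pow[of a s k] P.a_subset by auto
        moreover have "\<dots> = \<zero>\<^bsub>L\<^esub>"
          using S_pow[OF a(2)] by (subst fraction_eq_zero_iff) auto
        ultimately show ?thesis by auto
      qed
      have "fr z \<one> \<in> extended_ideal M" "fr z \<one> \<notin> extended_ideal P"
        using z inP[OF _ S_one, of z] inM[OF _ S_one, of z] by auto
      then show "extended_ideal M \<noteq> extended_ideal P" by auto
      fix f h assume fh: "f \<in> carrier L - extended_ideal P" "h \<in> extended_ideal M"
      then obtain a s b t where ab: "a \<in> carrier R" "s \<in> carrier R - M" "f = fr a s"
        "b \<in> M" "t \<in> carrier R - M" "h = fr b t"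
        unfolding extended_ideal_def by (blast elim: fraction_cases)
      then have "a \<in> carrier R - P" using fh inP[of a s] by auto
      from D[OF M this ab(4)] obtain k :: nat and u w where
        kuw: "u \<in> carrier R - M" "w \<in> carrier R" "b [^] k \<otimes> u = a \<otimes> w" by blast
      have tk: "t [^] k \<in> carrier R - M" using ab by (intro S_pow)
      have car: "b \<in> carrier R" "b [^] k \<in> carrier R" "t [^] k \<in> carrier R" "u \<in> carrier R" "s \<in> carrier R"
        using ab kuw by auto
      have "b [^] k \<otimes> (s \<otimes> (u \<otimes> t [^] k)) = (b [^] k \<otimes> u) \<otimes> (s \<otimes> t [^] k)"
        using car by (simp add: m_ac)
      also have "\<dots> = a \<otimes> (w \<otimes> s) \<otimes> t [^] k"
        unfolding kuw(3) using car ab(1) kuw(2) by (simp add: m_ac)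
      finally have eq: "b [^] k \<otimes> (s \<otimes> (u \<otimes> t [^] k)) = a \<otimes> (w \<otimes> s) \<otimes> t [^] k" .
      have ut: "u \<otimes> t [^] k \<in> carrier R - M" by (rule S_mult[OF kuw(1) tk])
      have ws: "w \<otimes> s \<in> carrier R" "a \<otimes> (w \<otimes> s) \<in> carrier R" using car ab(1) kuw(2) by simp_all
      have "h [^]\<^bsub>L\<^esub> k = fr (b [^] k) (t [^] k)"
        unfolding ab(6) by (rule fraction_pow[OF car(1) ab(5)])
      also have "\<dots> = fr (a \<otimes> (w \<otimes> s)) (s \<otimes> (u \<otimes> t [^] k))"
        by (rule fraction_eqI[OF car(2) ws(2) tk S_mult[OF ab(2) ut] eq])
      also have "\<dots> = f \<otimes>\<^bsub>L\<^esub> fr (w \<otimes> s) (u \<otimes> t [^] k)"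
        unfolding ab(3) by (rule fraction_mult[OF ab(1,2) ws(1) ut, symmetric])
      finally have "h [^]\<^bsub>L\<^esub> k = f \<otimes>\<^bsub>L\<^esub> fr (w \<otimes> s) (u \<otimes> t [^] k)" .
      moreover have "fr (w \<otimes> s) (u \<otimes> t [^] k) \<in> carrier L"
        by (rule fraction_closed[OF ws(1) ut])
      ultimately show "\<exists>k::nat. \<exists>w\<in>carrier L. h [^]\<^bsub>L\<^esub> k = f \<otimes>\<^bsub>L\<^esub> w" by blast
    qed
    also have "\<dots> \<longleftrightarrow> ?reg"
    proof
      assume "\<exists>x\<in>extended_ideal M. \<forall>y\<in>carrier L. x \<otimes>\<^bsub>L\<^esub> y = \<zero>\<^bsub>L\<^esub> \<longrightarrow> y = \<zero>\<^bsub>L\<^esub>"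
      then obtain a s where a: "a \<in> M" "s \<in> carrier R - M"
        and reg: "\<And>y. y \<in> carrier L \<Longrightarrow> fr a s \<otimes>\<^bsub>L\<^esub> y = \<zero>\<^bsub>L\<^esub> \<Longrightarrow> y = \<zero>\<^bsub>L\<^esub>"
        unfolding extended_ideal_def by blast
      have car: "a \<in> carrier R" "s \<in> carrier R" using a by auto
      show ?reg
      proof (intro bexI[OF _ a(1)] ballI impI)
        fix y assume y: "y \<in> carrier R" "\<exists>u\<in>carrier R - M. u \<otimes> (a \<otimes> y) = \<zero>"
        then have "fr (a \<otimes> y) s = \<zero>\<^bsub>L\<^esub>"
          using fraction_eq_zero_iff[OF m_closed[OF car(1) y(1)] a(2)] by simp
        then have "fr a s \<otimes>\<^bsub>L\<^esub> fr y \<one> = \<zero>\<^bsub>L\<^esub>"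
          using fraction_mult[OF car(1) a(2) y(1) S_one] car by simp
        then have "fr y \<one> = \<zero>\<^bsub>L\<^esub>" by (rule reg[OF fraction_closed[OF y(1) S_one]])
        then show "\<exists>u\<in>carrier R - M. u \<otimes> y = \<zero>" 
          using fraction_eq_zero_iff[OF y(1) S_one] by simp
      qed
    next
      assume ?reg
      then obtain a where a: "a \<in> M" and reg: "\<And>y. y \<in> carrier R \<Longrightarrow>
        \<exists>u\<in>carrier R - M. u \<otimes> (a \<otimes> y) = \<zero> \<Longrightarrow> \<exists>u\<in>carrier R - M. u \<otimes> y = \<zero>" by blast
      show "\<exists>x\<in>extended_ideal M. \<forall>y\<in>carrier L. x \<otimes>\<^bsub>L\<^esub> y = \<zero>\<^bsub>L\<^esub> \<longrightarrow> y = \<zero>\<^bsub>L\<^esub>"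
      proof (intro bexI[of _ "fr a \<one>"] ballI impI)
        show "fr a \<one> \<in> extended_ideal M" using a S_one by (auto simp: extended_ideal_def)
        fix y assume y: "y \<in> carrier L" "fr a \<one> \<otimes>\<^bsub>L\<^esub> y = \<zero>\<^bsub>L\<^esub>"
        then obtain b t where b: "b \<in> carrier R" "t \<in> carrier R - M" "y = fr b t"
          by (blast elim: fraction_cases)
        have ac: "a \<in> carrier R" "t \<in> carrier R" using a b(2) by auto
        have "fr (a \<otimes> b) t = \<zero>\<^bsub>L\<^esub>"
          using y(2) fraction_mult[OF ac(1) S_one b(1,2)] ac b(3) by simp
        then have "\<exists>u\<in>carrier R - M. u \<otimes> (a \<otimes> b) = \<zero>"
          using fraction_eq_zero_iff[OF m_closed[OF ac(1) b(1)] b(2)] by simp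
        from reg[OF b(1) this] show "y = \<zero>\<^bsub>L\<^esub>"
          unfolding b(3) using fraction_eq_zero_iff[OF b(1,2)] by simp
      qed
    qed
    finally show ?thesis .
  qed
  then show ?thesis
    unfolding cohen_macaulay_def using assms(1,2) by auto
qed

section \<open>The Hilbert basis theorem\<close>

lemma type_ring_simps [simp]:
  "carrier (ring_of_type_algebra :: 'a::comm_ring_1 ring) = UNIV"
  "x \<otimes>\<^bsub>(ring_of_type_algebra :: 'a ring)\<^esub> y = x * y"
  "x \<oplus>\<^bsub>(ring_of_type_algebra :: 'a ring)\<^esub> y = x + y"
  "\<zero>\<^bsub>(ring_of_type_algebra :: 'a ring)\<^esub> = 0"
  "\<one>\<^bsub>(ring_of_type_algebra :: 'a ring)\<^esub> = 1"
  by (simp_all add: ring_of_type_algebra_def)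

text \<open>
  Closure under additive inverses is the case \<open>r = -1\<close> of the last condition.
\<close>

lemma type_ring_ideal_iff:
  fixes I :: "'a::comm_ring_1 set"
  shows "ideal I ring_of_type_algebra \<longleftrightarrow>
    0 \<in> I \<and> (\<forall>x\<in>I. \<forall>y\<in>I. x + y \<in> I) \<and> (\<forall>x\<in>I. \<forall>r. r * x \<in> I)"
proof
  assume "ideal I ring_of_type_algebra"
  then interpret ideal I "ring_of_type_algebra :: 'a ring" .
  show "0 \<in> I \<and> (\<forall>x\<in>I. \<forall>y\<in>I. x + y \<in> I) \<and> (\<forall>x\<in>I. \<forall>r. r * x \<in> I)"
  proof (intro conjI ballI allI)
    show "0 \<in> I" using additive_subgroup.zero_closed[OF is_additive_subgroup] by (simp only: type_ring_simps)
    fix x assume x: "x \<in> I"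
    show "x + y \<in> I" if "y \<in> I" for y
      using additive_subgroup.a_closed[OF is_additive_subgroup x that] by (simp only: type_ring_simps)
    show "r * x \<in> I" for r
      using I_l_closed[OF x, of r] by (simp only: type_ring_simps UNIV_I simp_thms)
  qed
next
  assume I: "0 \<in> I \<and> (\<forall>x\<in>I. \<forall>y\<in>I. x + y \<in> I) \<and> (\<forall>x\<in>I. \<forall>r. r * x \<in> I)"
  interpret cring "ring_of_type_algebra :: 'a ring" by (rule cring_from_type_algebra)
  have neg: "\<ominus>\<^bsub>(ring_of_type_algebra :: 'a ring)\<^esub> x \<in> I" if "x \<in> I" for x
  proof -
    have "\<ominus>\<^bsub>(ring_of_type_algebra :: 'a ring)\<^esub> x = (-1) * x"
      by (rule minus_equality) (simp_all only: type_ring_simps UNIV_I mult_minus_left mult_1_left left_minus)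
    moreover have "(-1) * x \<in> I" using I that by blast
    ultimately show ?thesis by simp
  qed
  show "ideal I ring_of_type_algebra"
  proof (rule idealI[OF ring_axioms add.subgroupI])
    fix a x assume "a \<in> I" "x \<in> carrier (ring_of_type_algebra :: 'a ring)"
    then show "a \<otimes>\<^bsub>ring_of_type_algebra\<^esub> x \<in> I" "x \<otimes>\<^bsub>ring_of_type_algebra\<^esub> a \<in> I"
      using I by (auto simp: mult.commute[of a x])
  qed (use I neg in auto)
qed

lemma type_ring_genideal:
  fixes A I :: "'a::comm_ring_1 set"
  shows "ideal (Idl\<^bsub>ring_of_type_algebra\<^esub> A) (ring_of_type_algebra :: 'a ring)"
    "A \<subseteq> Idl\<^bsub>ring_of_type_algebra\<^esub> A"
    "ideal I ring_of_type_algebra \<Longrightarrow> A \<subseteq> I \<Longrightarrow> Idl\<^bsub>ring_of_type_algebra\<^esub> A \<subseteq> I"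
  by (rule ring.genideal_ideal[OF ring_from_type_algebra], simp)
    (rule ring.genideal_self[OF ring_from_type_algebra], simp,
     rule ring.genideal_minimal[OF ring_from_type_algebra])

text \<open>
  Of the two kinds of monotone subsequences, a decreasing one becomes constant where it attains its
  minimum.
\<close>

lemma mono_subseq_nat:
  fixes f :: "nat \<Rightarrow> nat"
  shows "\<exists>r :: nat \<Rightarrow> nat. strict_mono r \<and> mono (\<lambda>i. f (r i))"
proof -
  obtain r :: "nat \<Rightarrow> nat" where r: "strict_mono r" "monoseq (\<lambda>i. f (r i))"
    using seq_monosub by blast
  show ?thesis
  proof (cases "\<forall>m n. m \<le> n \<longrightarrow> f (r m) \<le> f (r n)")
    case True
    then show ?thesis using r(1) by (auto simp: mono_def)
  next
    case False
    then have dec: "f (r n) \<le> f (r m)" if "m \<le> n" for m n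
      using r(2) that unfolding monoseq_def by blast
    obtain N where N: "\<And>n. f (r N) \<le> f (r n)"
      using ex_has_least_nat[of "\<lambda>_. True" _ "\<lambda>n. f (r n)"] by auto
    have "f (r (N + i)) = f (r N)" for i
      using dec[of N "N + i"] N[of "N + i"] by simp
    moreover have "strict_mono (\<lambda>i. r (N + i))"
      using r(1) by (auto simp: strict_mono_def)
    ultimately show ?thesis by (intro exI[of _ "\<lambda>i. r (N + i)"]) (simp add: mono_def)
  qed
qed

text \<open>
  Dickson's lemma. Passing to a monotone subsequence once for each of the finitely many coordinates
  makes all of them monotone.
\<close>

lemma dickson_sequence:
  fixes m :: "nat \<Rightarrow> 'v::finite \<Rightarrow> nat"
  shows "\<exists>i j. i < j \<and> (\<forall>v. m i v \<le> m j v)"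
proof -
  have "\<exists>r :: nat \<Rightarrow> nat. strict_mono r \<and> (\<forall>v\<in>V. mono (\<lambda>i. m (r i) v))" if "finite V" for V :: "'v set"
    using that
  proof (induct V)
    case empty
    then show ?case by (auto intro: exI[of _ "\<lambda>i. i"] simp: strict_mono_def)
  next
    case (insert v V)
    then obtain r :: "nat \<Rightarrow> nat" where r: "strict_mono r" "\<forall>v\<in>V. mono (\<lambda>i. m (r i) v)" by blast
    obtain q :: "nat \<Rightarrow> nat" where q: "strict_mono q" "mono (\<lambda>i. m (r (q i)) v)"
      using mono_subseq_nat[of "\<lambda>i. m (r i) v"] by blast
    have "mono (\<lambda>i. m (r (q i)) w)" if "w \<in> V" for w
      using r(2) that q(1) by (auto simp: mono_def strict_mono_less_eq)
    with q r(1) show ?case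
      by (intro exI[of _ "\<lambda>i. r (q i)"]) (auto simp: strict_mono_def)
  qed
  from this[of UNIV] obtain r :: "nat \<Rightarrow> nat"
    where r: "strict_mono r" "\<And>v. mono (\<lambda>i. m (r i) v)" by auto
  have "r 0 < r 1" using r(1) by (auto simp: strict_mono_def)
  moreover have "m (r 0) v \<le> m (r 1) v" for v using r(2)[of v] by (auto simp: mono_def)
  ultimately show ?thesis by blast
qed

abbreviation mdvd :: "('v \<Rightarrow>\<^sub>0 nat) \<Rightarrow> ('v \<Rightarrow>\<^sub>0 nat) \<Rightarrow> bool" where
  "mdvd m m' \<equiv> \<forall>v. Poly_Mapping.lookup m v \<le> Poly_Mapping.lookup m' v"

lemma mdvd_imp_add: "mdvd m m' \<Longrightarrow> m + (m' - m) = m'"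
  by (rule poly_mapping_eqI) (simp add: lookup_add lookup_minus)

lemma poly_mapping_nat_zero_le: "(0 :: 'v::linorder \<Rightarrow>\<^sub>0 nat) \<le> m"
proof (cases "m = 0")
  case False
  define x where "x = Min (Poly_Mapping.keys m)"
  have ne: "Poly_Mapping.keys m \<noteq> {}" using False by auto
  have "x \<in> Poly_Mapping.keys m" unfolding x_def using ne by simp
  moreover have "y \<notin> Poly_Mapping.keys m" if "y < x" for y
    using that unfolding x_def using ne by (metis Min_le finite_keys leD)
  ultimately have "0 < m"
    by (auto simp: less_poly_mapping.rep_eq less_fun_def in_keys_iff intro!: exI[of _ x])
  then show ?thesis by simp
qed simp

lemma mdvd_imp_le: "mdvd m m' \<Longrightarrow> m \<le> m'" for m m' :: "'v::linorder \<Rightarrow>\<^sub>0 nat"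
  using add_left_mono[OF poly_mapping_nat_zero_le, of m "m' - m"] mdvd_imp_add[of m m'] by simp

text \<open>
  The lexicographic order extends divisibility, so a descending sequence of monomials would
  contradict Dickson's lemma.
\<close>

lemma wf_monomials: "wf {(m, m' :: 'v::{finite,linorder} \<Rightarrow>\<^sub>0 nat). m < m'}"
  unfolding wf_iff_no_infinite_down_chain
proof
  assume "\<exists>f. \<forall>i. (f (Suc i), f i) \<in> {(m, m' :: 'v \<Rightarrow>\<^sub>0 nat). m < m'}"
  then obtain f :: "nat \<Rightarrow> 'v \<Rightarrow>\<^sub>0 nat" where f: "\<And>i. f (Suc i) < f i" by auto
  have dec: "f j < f i" if "i < j" for i j
    using that by (induct rule: less_Suc_induct) (use f in \<open>auto intro: less_trans\<close>)
  obtain i j where "i < j" "mdvd (f i) (f j)"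
    using dickson_sequence[of "\<lambda>i. Poly_Mapping.lookup (f i)"] by blast
  then show False using dec[of i j] mdvd_imp_le[of "f i" "f j"] by simp
qed

text \<open>
  The monomials of \<open>L\<close> that are minimal for divisibility form an antichain, which is finite since an
  injective sequence in it would contain a comparable pair.
\<close>

lemma dickson_finite_basis:
  fixes L :: "('v::{finite,linorder} \<Rightarrow>\<^sub>0 nat) set"
  shows "\<exists>B. finite B \<and> B \<subseteq> L \<and> (\<forall>m\<in>L. \<exists>b\<in>B. mdvd b m)"
proof -
  define B where "B = {b \<in> L. \<forall>m\<in>L. mdvd m b \<longrightarrow> m = b}"
  have "finite B"
  proof (rule ccontr)
    assume "infinite B"
    then obtain f :: "nat \<Rightarrow> 'v \<Rightarrow>\<^sub>0 nat" where f: "inj f" "range f \<subseteq> B"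
      using infinite_countable_subset by blast
    obtain i j where ij: "i < j" "mdvd (f i) (f j)"
      using dickson_sequence[of "\<lambda>i. Poly_Mapping.lookup (f i)"] by blast
    have "f i \<in> L" "f j \<in> B" using f(2) by (auto simp: B_def)
    then have "f i = f j" using ij(2) unfolding B_def by blast
    then show False using f(1) ij(1) by (auto dest: injD)
  qed
  moreover have "\<exists>b\<in>B. mdvd b m" if "m \<in> L" for m
    using that
  proof (induct m rule: wf_induct_rule[OF wf_monomials])
    case (1 m)
    show ?case
    proof (cases "m \<in> B")
      case False
      then obtain m' where m': "m' \<in> L" "mdvd m' m" "m' \<noteq> m" using 1(2) by (auto simp: B_def)
      then have "m' < m" using mdvd_imp_le[of m' m] by simp
      then obtain b where "b \<in> B" "mdvd b m'" using 1(1)[of m'] m' by auto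
      then show ?thesis using m'(2) order_trans by blast
    qed auto
  qed
  moreover have "B \<subseteq> L" by (auto simp: B_def)
  ultimately show ?thesis by blast
qed

lemma lookup_single_times:
  fixes f :: "('v \<Rightarrow>\<^sub>0 nat) \<Rightarrow>\<^sub>0 'k::comm_ring_1"
  shows "Poly_Mapping.lookup (Poly_Mapping.single m c * f) (m + k) = c * Poly_Mapping.lookup f k"
proof -
  have "Poly_Mapping.lookup (Poly_Mapping.single m c * f) (m + k)
    = (\<Sum>l. (c * (\<Sum>q. (Poly_Mapping.lookup f q when m + k = l + q))) when l = m)"
    unfolding lookup_mult by (rule Sum_any.cong) (auto simp: lookup_single when_def)
  then show ?thesis by simp
qed

lemma keys_single_times:
  "Poly_Mapping.keys (Poly_Mapping.single m c * f) \<subseteq> (+) m ` Poly_Mapping.keys f"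
  using keys_mult[of "Poly_Mapping.single m c" f] by (auto split: if_splits)

text \<open>
  Hilbert's basis theorem by division: \<open>A\<close> realizes a finite set of leading monomials that divide
  all leading monomials of the ideal, and subtracting a multiple of an element of \<open>A\<close> removes the
  leading term of any other element.
\<close>

theorem mpoly_ring_noetherian:
  "noetherian_ring (mpoly_ring :: ('v::{finite,linorder}, 'k::field) mpoly ring)"
proof -
  let ?lm = "\<lambda>f :: ('v, 'k) mpoly. Max (Poly_Mapping.keys f)"
  show ?thesis
  proof (rule ring.noetherian_ringI[OF ring_from_type_algebra])
    let ?R = "mpoly_ring :: ('v, 'k) mpoly ring"
    fix Q :: "('v, 'k) mpoly set" assume Q: "ideal Q ?R"
    obtain B where B': "finite B \<and> B \<subseteq> ?lm ` (Q - {0}) \<and> (\<forall>m\<in>?lm ` (Q - {0}). \<exists>b\<in>B. mdvd b m)"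
      using dickson_finite_basis by (rule exE)
    then have B: "finite B" "B \<subseteq> ?lm ` (Q - {0})" by simp_all
    have B_dvd: "\<exists>b\<in>B. mdvd b (?lm f)" if "f \<in> Q" "f \<noteq> 0" for f
      using B' that by blast
    obtain A where A: "A \<subseteq> Q - {0}" "finite A" "B = ?lm ` A"
      using finite_subset_image[OF B] by blast
    have GI: "0 \<in> Idl\<^bsub>?R\<^esub> A" "\<And>x y. x \<in> Idl\<^bsub>?R\<^esub> A \<Longrightarrow> y \<in> Idl\<^bsub>?R\<^esub> A \<Longrightarrow> x + y \<in> Idl\<^bsub>?R\<^esub> A"
      "\<And>x r. x \<in> Idl\<^bsub>?R\<^esub> A \<Longrightarrow> r * x \<in> Idl\<^bsub>?R\<^esub> A"
      using type_ring_genideal(1)[of A] unfolding type_ring_ideal_iff by auto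
    have QI: "\<And>x y. x \<in> Q \<Longrightarrow> y \<in> Q \<Longrightarrow> x + y \<in> Q" "\<And>x r. x \<in> Q \<Longrightarrow> r * x \<in> Q"
      using Q unfolding type_ring_ideal_iff by auto
    have "f \<in> Idl\<^bsub>?R\<^esub> A" if "f \<in> Q" "?lm f = m" for f m
      using that
    proof (induct m arbitrary: f rule: wf_induct_rule[OF wf_monomials])
      case (1 m)
      show ?case
      proof (cases "f = 0")
        case False
        then obtain g where g: "g \<in> A" "mdvd (?lm g) m"
          using B_dvd[OF 1(2)] 1(3) A(3) by blast
        define k where "k = m - ?lm g"
        have k: "m = k + ?lm g" using mdvd_imp_add[OF g(2)] by (simp add: k_def add.commute)
        have g0: "g \<noteq> 0" "g \<in> Q" using g A by auto
        then have lg: "?lm g \<in> Poly_Mapping.keys g" by (intro Max_in) auto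
        define c where "c = Poly_Mapping.lookup f m / Poly_Mapping.lookup g (?lm g)"
        define h where "h = Poly_Mapping.single k c * g"
        have gA: "g \<in> Idl\<^bsub>?R\<^esub> A" using type_ring_genideal(2)[of A] g(1) by auto
        have hQ: "f - h \<in> Q"
          using QI(1)[OF 1(2) QI(2)[OF g0(2), of "- Poly_Mapping.single k c"]] by (simp add: h_def)
        have top: "Poly_Mapping.lookup (f - h) m = 0"
          using lg by (simp add: h_def lookup_minus k lookup_single_times c_def in_keys_iff)
        have le: "x \<le> m" if "x \<in> Poly_Mapping.keys (f - h)" for x
        proof -
          have "x \<in> Poly_Mapping.keys f \<or> x \<in> Poly_Mapping.keys h"
            using that by (auto simp: in_keys_iff lookup_minus)
          then show ?thesis
          proof
            assume "x \<in> Poly_Mapping.keys f"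
            then show ?thesis using 1(3) by auto
          next
            assume "x \<in> Poly_Mapping.keys h"
            then obtain y where "y \<in> Poly_Mapping.keys g" "x = k + y"
              using keys_single_times[of k c g] by (auto simp: h_def)
            then show ?thesis unfolding k by (auto intro!: add_left_mono)
          qed
        qed
        have "f - h \<in> Idl\<^bsub>?R\<^esub> A"
        proof (cases "f - h = 0")
          case False
          then have "?lm (f - h) \<in> Poly_Mapping.keys (f - h)" by (intro Max_in) auto
          then have "?lm (f - h) < m"
            using le[of "?lm (f - h)"] top by (auto simp: in_keys_iff order_less_le)
          then show ?thesis using 1(1)[of "?lm (f - h)" "f - h"] hQ by auto
        qed (use GI in auto)
        from GI(2)[OF this GI(3)[OF gA, of "Poly_Mapping.single k c"]]
        show ?thesis by (simp add: h_def)
      qed (use GI in auto)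
    qed
    then have "Q \<subseteq> Idl\<^bsub>?R\<^esub> A" by auto
    moreover have "Idl\<^bsub>?R\<^esub> A \<subseteq> Q" using A by (intro type_ring_genideal(3)[OF Q]) auto
    ultimately show "\<exists>A\<subseteq>carrier ?R. finite A \<and> Q = Idl\<^bsub>?R\<^esub> A" using A(2) by auto
  qed
qed

section \<open>The tangent cone of a monomial curve\<close>

lemma poly_mapping_sum_singles: "f = (\<Sum>m\<in>Poly_Mapping.keys f. Poly_Mapping.single m (Poly_Mapping.lookup f m))"
  by (rule poly_mapping_eqI) (auto simp: lookup_sum lookup_single when_def in_keys_iff)

lemma type_ring_ideal_sum:
  assumes "ideal I (ring_of_type_algebra :: 'a::comm_ring_1 ring)" "\<And>x. x \<in> A \<Longrightarrow> g x \<in> I"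
  shows "sum g A \<in> I"
  using assms(2) by (induct A rule: infinite_finite_induct) (use assms(1) in \<open>auto simp: type_ring_ideal_iff\<close>)

text \<open>
  The linear functional that takes the value \<open>1\<close> on the monomials of \<open>T\<close> and \<open>0\<close> on the others.
  Both the ideal of the curve and its tangent ideal are common kernels of such functionals, which
  turns statements about polynomials into statements about sets of monomials.
\<close>

definition coeff_sum :: "('v \<Rightarrow>\<^sub>0 nat) set \<Rightarrow> ('v, 'k::comm_ring_1) mpoly \<Rightarrow> 'k" where
  "coeff_sum T f = (\<Sum>m\<in>Poly_Mapping.keys f \<inter> T. Poly_Mapping.lookup f m)"

lemma coeff_sum_superset:
  assumes "finite A" "Poly_Mapping.keys f \<subseteq> A"
  shows "coeff_sum T f = (\<Sum>m\<in>A \<inter> T. Poly_Mapping.lookup f m)"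
  unfolding coeff_sum_def by (rule sum.mono_neutral_left) (use assms in \<open>auto simp: in_keys_iff\<close>)

lemma coeff_sum_add [simp]: "coeff_sum T (f + g) = coeff_sum T f + coeff_sum T g"
proof -
  let ?A = "Poly_Mapping.keys f \<union> Poly_Mapping.keys g"
  show ?thesis
    using coeff_sum_superset[of ?A f T] coeff_sum_superset[of ?A g T]
      coeff_sum_superset[of ?A "f + g" T] keys_add[of f g]
    by (simp add: lookup_add sum.distrib)
qed

lemma coeff_sum_zero [simp]: "coeff_sum T 0 = 0" "coeff_sum {} f = 0"
  by (simp_all add: coeff_sum_def)

lemma coeff_sum_uminus [simp]: "coeff_sum T (- f) = - coeff_sum T f"
  using coeff_sum_add[of T "- f" f] by (simp add: add_eq_0_iff2 del: coeff_sum_add)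

lemma coeff_sum_diff [simp]: "coeff_sum T (f - g) = coeff_sum T f - coeff_sum T g"
  using coeff_sum_add[of T f "- g"] by (simp del: coeff_sum_add)

lemma coeff_sum_sum [simp]: "coeff_sum T (sum g A) = (\<Sum>x\<in>A. coeff_sum T (g x))"
  by (induct A rule: infinite_finite_induct) auto

lemma coeff_sum_single [simp]: "coeff_sum T (Poly_Mapping.single m c) = (if m \<in> T then c else 0)"
  by (simp add: coeff_sum_def)

lemma coeff_sum_single_times:
  "coeff_sum T (Poly_Mapping.single m c * f) = c * coeff_sum ((+) m -` T) f"
proof -
  have "coeff_sum T (Poly_Mapping.single m c * f)
      = (\<Sum>x\<in>((+) m ` Poly_Mapping.keys f) \<inter> T. Poly_Mapping.lookup (Poly_Mapping.single m c * f) x)"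
    by (rule coeff_sum_superset) (use keys_single_times[of m c f] in auto)
  also have "((+) m ` Poly_Mapping.keys f) \<inter> T = (+) m ` (Poly_Mapping.keys f \<inter> (+) m -` T)"
    by auto
  also have "(\<Sum>x\<in>\<dots>. Poly_Mapping.lookup (Poly_Mapping.single m c * f) x)
      = (\<Sum>k\<in>Poly_Mapping.keys f \<inter> (+) m -` T. c * Poly_Mapping.lookup f k)"
    by (subst sum.reindex) (auto simp: lookup_single_times intro: inj_onI)
  also have "\<dots> = c * coeff_sum ((+) m -` T) f"
    by (simp add: coeff_sum_def sum_distrib_left)
  finally show ?thesis .
qed

lemma coeff_sum_times:
  "coeff_sum T (f * g) =
    (\<Sum>m\<in>Poly_Mapping.keys f. Poly_Mapping.lookup f m * coeff_sum ((+) m -` T) g)"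
proof -
  have "f * g = (\<Sum>m\<in>Poly_Mapping.keys f. Poly_Mapping.single m (Poly_Mapping.lookup f m) * g)"
    by (subst poly_mapping_sum_singles[of f]) (rule sum_distrib_right)
  then show ?thesis by (simp add: coeff_sum_single_times)
qed

definition weight :: "('v::finite \<Rightarrow> nat) \<Rightarrow> ('v \<Rightarrow>\<^sub>0 nat) \<Rightarrow> nat" where
  "weight n m = (\<Sum>i\<in>UNIV. n i * Poly_Mapping.lookup m i)"

lemma weight_add [simp]: "weight n (m + k) = weight n m + weight n k"
  by (simp add: weight_def lookup_add distrib_left sum.distrib)

lemma total_degree_add [simp]: "total_degree (m + k) = total_degree m + total_degree k"
  by (simp add: total_degree_def lookup_add sum.distrib)

lemma weight_zero [simp]: "weight n 0 = 0"
  by (simp add: weight_def)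

lemma weight_single [simp]: "weight n (Poly_Mapping.single i a) = n i * a"
proof -
  have "weight n (Poly_Mapping.single i a) = (\<Sum>j\<in>UNIV. if i = j then n i * a else 0)"
    unfolding weight_def by (rule sum.cong) (auto simp: lookup_single)
  then show ?thesis by simp
qed

lemma total_degree_single [simp]: "total_degree (Poly_Mapping.single i a) = a"
proof -
  have "total_degree (Poly_Mapping.single i a) = (\<Sum>j\<in>UNIV. if i = j then a else 0)"
    unfolding total_degree_def by (rule sum.cong) (auto simp: lookup_single)
  then show ?thesis by simp
qed

lemma curve_ideal_iff:
  "f \<in> curve_ideal n \<longleftrightarrow> (\<forall>s. coeff_sum {m. weight n m = s} f = 0)"
proof -
  have mono: "(\<Prod>i\<in>A. (Polynomial.monom 1 (n i)) ^ e i) = Polynomial.monom (1::'b) (\<Sum>i\<in>A. n i * e i)"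
    for A :: "'a set" and e
    by (induct A rule: infinite_finite_induct) (auto simp: monom_power mult_monom)
  have "coeff (curve_map n f) s = coeff_sum {m. weight n m = s} f" for s
  proof -
    have "coeff (curve_map n f) s
      = (\<Sum>m\<in>Poly_Mapping.keys f. if weight n m = s then Poly_Mapping.lookup f m else 0)"
      unfolding curve_map_def mono coeff_sum
      by (rule sum.cong) (auto simp: weight_def)
    also have "\<dots> = coeff_sum {m. weight n m = s} f"
      unfolding coeff_sum_def by (simp add: sum.If_cases Int_def conj_commute)
    finally show ?thesis .
  qed
  then show ?thesis by (auto simp: curve_ideal_def poly_eq_iff)
qed

lemma lookup_least_form:
  "Poly_Mapping.lookup (least_form f) m =
    (if m \<in> Poly_Mapping.keys f \<and> total_degree m = Min (total_degree ` Poly_Mapping.keys f)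
     then Poly_Mapping.lookup f m else 0)"
  unfolding least_form_def by (auto simp: lookup_sum lookup_single when_def in_keys_iff)

lemma least_form_binomial:
  fixes c :: "'k::comm_ring_1"
  assumes "a \<noteq> b" "c \<noteq> 0" "total_degree a \<le> total_degree b"
  shows "least_form (Poly_Mapping.single a c - Poly_Mapping.single b c) =
    (if total_degree a = total_degree b then Poly_Mapping.single a c - Poly_Mapping.single b c
     else Poly_Mapping.single a c)"
proof -
  let ?f = "Poly_Mapping.single a c - Poly_Mapping.single b c"
  have keys: "Poly_Mapping.keys ?f = {a, b}"
    using assms by (auto simp: in_keys_iff lookup_minus lookup_single when_def split: if_splits)
  have "Min (total_degree ` Poly_Mapping.keys ?f) = total_degree a"
    unfolding keys using assms(3) by (simp add: min_def)
  then show ?thesis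
    using assms(1) by (intro poly_mapping_eqI)
      (auto simp: lookup_least_form keys lookup_minus lookup_single when_def)
qed

lemma binomial_in_curve_ideal:
  "weight n a = weight n b \<Longrightarrow> Poly_Mapping.single a c - Poly_Mapping.single b c \<in> curve_ideal n"
  by (simp add: curve_ideal_iff)

text \<open>
  The order of \<open>t\<^sup>s\<close> with respect to the maximal ideal of the semigroup ring. It is only meant for
  \<open>s\<close> in the semigroup, since \<open>Max\<close> of the empty set is unspecified.
\<close>

definition max_degree :: "('v::finite \<Rightarrow> nat) \<Rightarrow> nat \<Rightarrow> nat" where
  "max_degree n s = Max (total_degree ` {m. weight n m = s})"

definition top_monomials :: "('v::finite \<Rightarrow> nat) \<Rightarrow> nat \<Rightarrow> ('v \<Rightarrow>\<^sub>0 nat) set" where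
  "top_monomials n s = {m. weight n m = s \<and> total_degree m = max_degree n s}"

text \<open>
  The kernel of the map from \<open>K[x]\<close> to the associated graded ring of the semigroup ring, which has
  one basis element for each \<open>s\<close> in the semigroup, in degree \<open>max_degree n s\<close>: a monomial of weight
  \<open>s\<close> goes to that element if its degree is maximal, and to \<open>0\<close> otherwise.
\<close>

definition graded_kernel :: "('v::finite \<Rightarrow> nat) \<Rightarrow> ('v, 'k::comm_ring_1) mpoly set" where
  "graded_kernel n = {f. \<forall>s. coeff_sum (top_monomials n s) f = 0}"

locale positive_weights =
  fixes n :: "'v::finite \<Rightarrow> nat"
  assumes pos: "0 < n i"
begin

lemma lookup_le_weight: "Poly_Mapping.lookup m i \<le> weight n m"
proof -
  have "Poly_Mapping.lookup m i \<le> n i * Poly_Mapping.lookup m i" using pos[of i] by simp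
  also have "\<dots> \<le> weight n m" unfolding weight_def by (rule member_le_sum) auto
  finally show ?thesis .
qed

lemma weight_eq_0_iff: "weight n m = 0 \<longleftrightarrow> m = 0"
proof
  assume "weight n m = 0"
  then show "m = 0" using lookup_le_weight[of m] by (intro poly_mapping_eqI) simp
qed simp

lemma finite_weight: "finite {m. weight n m = s}"
proof (rule finite_imageD)
  show "inj_on Poly_Mapping.lookup {m. weight n m = s}"
    by (rule inj_onI) (simp add: lookup_inject)
  have "Poly_Mapping.lookup ` {m. weight n m = s} \<subseteq> (UNIV \<rightarrow>\<^sub>E {..s})"
  proof
    fix e assume "e \<in> Poly_Mapping.lookup ` {m. weight n m = s}"
    then obtain m where "e = Poly_Mapping.lookup m" "weight n m = s" by blast
    then show "e \<in> UNIV \<rightarrow>\<^sub>E {..s}" using lookup_le_weight[of m] by auto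
  qed
  then show "finite (Poly_Mapping.lookup ` {m. weight n m = s})"
    by (rule finite_subset) (simp add: finite_PiE)
qed

lemma total_degree_le_max: "total_degree m \<le> max_degree n (weight n m)"
  unfolding max_degree_def by (rule Max_ge) (use finite_weight in auto)

lemma top_monomials_nonempty: "\<exists>k. k \<in> top_monomials n (weight n m)"
proof -
  have "max_degree n (weight n m) \<in> total_degree ` {k. weight n k = weight n m}"
    unfolding max_degree_def by (rule Max_in) (use finite_weight in auto)
  then show ?thesis by (auto simp: top_monomials_def)
qed

lemma max_degree_add: "total_degree m + max_degree n (weight n k) \<le> max_degree n (weight n m + weight n k)"
proof -
  obtain k' where "k' \<in> top_monomials n (weight n k)" using top_monomials_nonempty by blast
  then show ?thesis using total_degree_le_max[of "m + k'"] by (simp add: top_monomials_def)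
qed

text \<open>
  A factor of a monomial of maximal degree has maximal degree for its own weight, since otherwise
  it could be replaced by a better one. Hence dividing by \<open>m\<close> carries one set of top monomials onto
  another as soon as any top monomial is divisible by \<open>m\<close>.
\<close>

lemma vimage_top_monomials:
  assumes "m + k \<in> top_monomials n s"
  shows "weight n m \<le> s" "(+) m -` top_monomials n s = top_monomials n (s - weight n m)"
    "k \<in> top_monomials n (s - weight n m)"
proof -
  have s: "s = weight n m + weight n k" "total_degree m + total_degree k = max_degree n s"
    using assms by (auto simp: top_monomials_def)
  show "weight n m \<le> s" using s by simp
  have "total_degree k = max_degree n (weight n k)"
    using max_degree_add[of m k] total_degree_le_max[of k] s by simp
  then have D: "max_degree n s = total_degree m + max_degree n (weight n k)" using s(2) by simp
  show "(+) m -` top_monomials n s = top_monomials n (s - weight n m)"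
    using D by (auto simp: top_monomials_def s(1))
  show "k \<in> top_monomials n (s - weight n m)"
    using D s(2) by (simp add: top_monomials_def s(1))
qed

lemma vimage_top_monomials_cases:
  "(+) m -` top_monomials n s = {} \<or>
    weight n m \<le> s \<and> (+) m -` top_monomials n s = top_monomials n (s - weight n m)"
proof (cases "(+) m -` top_monomials n s = {}")
  case False
  then obtain k where "m + k \<in> top_monomials n s" by auto
  from vimage_top_monomials(1,2)[OF this] show ?thesis by simp
qed simp

text \<open>
  By the previous lemma, multiplying \<open>f\<close> by a monomial replaces each defining functional by another
  one of the same kind, or by zero.
\<close>

lemma ideal_graded_kernel: "ideal (graded_kernel n :: ('v, 'k::comm_ring_1) mpoly set) mpoly_ring"
  unfolding type_ring_ideal_iff
proof (intro conjI ballI allI)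
  fix f r :: "('v, 'k) mpoly" assume f: "f \<in> graded_kernel n"
  have "coeff_sum ((+) m -` top_monomials n s) f = 0" for m s
    using vimage_top_monomials_cases[of m s] f by (auto simp: graded_kernel_def)
  then show "r * f \<in> graded_kernel n"
    by (simp add: graded_kernel_def coeff_sum_times)
qed (auto simp: graded_kernel_def)

text \<open>
  A least form is homogeneous of degree \<open>d\<close>, say. For a weight \<open>s\<close> with \<open>max_degree n s = d\<close>, no
  monomial of \<open>f\<close> of weight \<open>s\<close> is dropped from \<open>f\<close>, because its degree is at least \<open>d\<close> and at most
  \<open>max_degree n s\<close>; for the other \<open>s\<close> no top monomial occurs. Conversely, fix a top monomial
  \<open>t s\<close> for each weight. The least form of \<open>m - t s\<close> with \<open>m\<close> of weight \<open>s\<close> is \<open>m\<close> or \<open>m - t s\<close>,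
  according to whether the degree of \<open>m\<close> is smaller or maximal. Subtracting these forms reduces any
  polynomial to a combination of the \<open>t s\<close> whose coefficients are the defining functionals.
\<close>

theorem tangent_ideal_curve_ideal:
  "tangent_ideal (curve_ideal n :: ('v, 'k::comm_ring_1) mpoly set) = graded_kernel n"
proof
  show "tangent_ideal (curve_ideal n :: ('v, 'k) mpoly set) \<subseteq> graded_kernel n"
    unfolding tangent_ideal_def
  proof (rule type_ring_genideal(3)[OF ideal_graded_kernel])
    have "least_form f \<in> graded_kernel n" if f: "f \<in> curve_ideal n" for f :: "('v, 'k) mpoly"
      unfolding graded_kernel_def
    proof (intro CollectI allI)
      fix s
      let ?d = "Min (total_degree ` Poly_Mapping.keys f)"
      have cs: "coeff_sum (top_monomials n s) (least_form f)
          = (\<Sum>m\<in>Poly_Mapping.keys f \<inter> top_monomials n s. Poly_Mapping.lookup (least_form f) m)"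
        by (rule coeff_sum_superset) (auto simp: in_keys_iff lookup_least_form split: if_splits)
      show "coeff_sum (top_monomials n s) (least_form f) = 0"
      proof (cases "max_degree n s = ?d")
        case True
        have "Poly_Mapping.keys f \<inter> top_monomials n s = Poly_Mapping.keys f \<inter> {m. weight n m = s}"
        proof -
          have "total_degree m = ?d" if "m \<in> Poly_Mapping.keys f" "weight n m = s" for m
          proof -
            have "total_degree m \<le> ?d"
              using total_degree_le_max[of m] unfolding that(2) True .
            moreover have "?d \<le> total_degree m" using that(1) by (intro Min_le) auto
            ultimately show ?thesis by (rule antisym)
          qed
          then show ?thesis using True by (auto simp: top_monomials_def)
        qed
        moreover have "Poly_Mapping.lookup (least_form f) m = Poly_Mapping.lookup f m"
          if "m \<in> Poly_Mapping.keys f \<inter> top_monomials n s" for m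
          using that True by (simp add: lookup_least_form top_monomials_def)
        ultimately have "coeff_sum (top_monomials n s) (least_form f) = coeff_sum {m. weight n m = s} f"
          unfolding cs unfolding coeff_sum_def by (intro sum.cong) auto
        then show ?thesis using f by (simp add: curve_ideal_iff)
      next
        case False
        have "Poly_Mapping.lookup (least_form f) m = 0" if "m \<in> top_monomials n s" for m
        proof -
          have "total_degree m \<noteq> ?d" using that False by (simp add: top_monomials_def)
          then show ?thesis unfolding lookup_least_form by (simp only: simp_thms if_False)
        qed
        then show ?thesis unfolding cs by (intro sum.neutral) blast
      qed
    qed
    then show "least_form ` (curve_ideal n :: ('v, 'k) mpoly set) \<subseteq> graded_kernel n" by auto
  qed
  let ?J = "tangent_ideal (curve_ideal n :: ('v, 'k) mpoly set)"
  have J: "ideal ?J mpoly_ring" unfolding tangent_ideal_def by (rule type_ring_genideal)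
  have J0: "0 \<in> ?J" and Jadd: "\<And>x y. x \<in> ?J \<Longrightarrow> y \<in> ?J \<Longrightarrow> x + y \<in> ?J"
    using J unfolding type_ring_ideal_iff by auto
  have least: "least_form f \<in> ?J" if "f \<in> curve_ideal n" for f :: "('v, 'k) mpoly"
    using type_ring_genideal(2)[of "least_form ` (curve_ideal n :: ('v, 'k) mpoly set)"] that
    unfolding tangent_ideal_def by auto
  define t where "t s = (SOME k. k \<in> top_monomials n s)" for s
  have t: "weight n (t (weight n m)) = weight n m"
    "total_degree (t (weight n m)) = max_degree n (weight n m)" for m
    using someI_ex[OF top_monomials_nonempty[of m]] by (auto simp: t_def top_monomials_def)
  show "graded_kernel n \<subseteq> ?J"
  proof
    fix f :: "('v, 'k) mpoly" assume f: "f \<in> graded_kernel n"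
    let ?c = "Poly_Mapping.lookup f" and ?K = "Poly_Mapping.keys f"
    define top where "top m \<longleftrightarrow> total_degree m = max_degree n (weight n m)" for m
    let ?r = "\<lambda>m. if top m then Poly_Mapping.single (t (weight n m)) (?c m) else 0"
    have red: "Poly_Mapping.single m (?c m) - ?r m \<in> ?J" if m: "m \<in> ?K" for m
    proof -
      let ?b = "Poly_Mapping.single m (?c m) - Poly_Mapping.single (t (weight n m)) (?c m)"
      show ?thesis
      proof (cases "m = t (weight n m)")
        case True
        then have "top m" using t[of m] by (simp add: top_def)
        with True J0 show ?thesis by simp
      next
        case False
        have "least_form ?b \<in> ?J" by (rule least, rule binomial_in_curve_ideal) (simp add: t)
        moreover have "total_degree m \<le> total_degree (t (weight n m))"
          using total_degree_le_max[of m] t[of m] by simp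
        ultimately show ?thesis
          using False m least_form_binomial[of m "t (weight n m)" "?c m"] t[of m]
          by (auto simp: top_def in_keys_iff split: if_splits)
      qed
    qed
    have "(\<Sum>m\<in>?K. ?r m) = (\<Sum>s\<in>weight n ` ?K. \<Sum>m\<in>{m \<in> ?K. weight n m = s}. ?r m)"
      by (rule sum.image_gen) simp
    also have "\<dots> = (\<Sum>s\<in>weight n ` ?K. Poly_Mapping.single (t s) (coeff_sum (top_monomials n s) f))"
    proof (rule sum.cong[OF refl])
      fix s
      have "(\<Sum>m\<in>{m \<in> ?K. weight n m = s}. ?r m)
          = (\<Sum>m\<in>{m \<in> ?K. weight n m = s} \<inter> {m. top m}. Poly_Mapping.single (t s) (?c m))"
        by (subst sum.inter_restrict) (auto intro!: sum.cong)
      also have "{m \<in> ?K. weight n m = s} \<inter> {m. top m} = ?K \<inter> top_monomials n s"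
        by (auto simp: top_def top_monomials_def)
      also have "(\<Sum>m\<in>\<dots>. Poly_Mapping.single (t s) (?c m))
          = Poly_Mapping.single (t s) (coeff_sum (top_monomials n s) f)"
        unfolding coeff_sum_def
        by (rule poly_mapping_eqI) (simp add: lookup_sum lookup_single when_def)
      finally show "(\<Sum>m\<in>{m \<in> ?K. weight n m = s}. ?r m)
          = Poly_Mapping.single (t s) (coeff_sum (top_monomials n s) f)" .
    qed
    also have "\<dots> = 0" using f by (simp add: graded_kernel_def)
    finally have "f = (\<Sum>m\<in>?K. Poly_Mapping.single m (?c m) - ?r m)"
      using poly_mapping_sum_singles[of f] by (simp add: sum_subtractf)
    moreover have "\<dots> \<in> ?J" by (rule type_ring_ideal_sum[OF J red])
    ultimately show "f \<in> ?J" by simp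
  qed
qed

text \<open>
  Multiplication by \<open>x\<^sub>i\<close> sends the basis element of weight \<open>s\<close> to the one of weight \<open>s + n i\<close> if the
  maximal degree grows by exactly one, and kills it if the degree grows by more.
\<close>

lemma pvar_regular_iff:
  "(\<forall>f :: ('v, 'k::comm_ring_1) mpoly. pvar i * f \<in> graded_kernel n \<longrightarrow> f \<in> graded_kernel n) \<longleftrightarrow>
    (\<forall>m. max_degree n (weight n m + n i) = Suc (max_degree n (weight n m)))"
proof
  assume reg: "\<forall>f :: ('v, 'k) mpoly. pvar i * f \<in> graded_kernel n \<longrightarrow> f \<in> graded_kernel n"
  show "\<forall>m. max_degree n (weight n m + n i) = Suc (max_degree n (weight n m))"
  proof
    fix m
    obtain k where k: "k \<in> top_monomials n (weight n m)" using top_monomials_nonempty by blast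
    let ?f = "Poly_Mapping.single k 1 :: ('v, 'k) mpoly"
    have "coeff_sum (top_monomials n (weight n m)) ?f \<noteq> 0" using k by simp
    then have "?f \<notin> graded_kernel n" unfolding graded_kernel_def by blast
    then have "pvar i * ?f \<notin> graded_kernel n" using reg by blast
    then obtain s where "Poly_Mapping.single i 1 + k \<in> top_monomials n s"
      by (auto simp: graded_kernel_def pvar_def mult_single split: if_splits)
    then show "max_degree n (weight n m + n i) = Suc (max_degree n (weight n m))"
      using k by (auto simp: top_monomials_def add.commute)
  qed
next
  assume C: "\<forall>m. max_degree n (weight n m + n i) = Suc (max_degree n (weight n m))"
  show "\<forall>f :: ('v, 'k) mpoly. pvar i * f \<in> graded_kernel n \<longrightarrow> f \<in> graded_kernel n"
  proof (intro allI impI)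
    fix f :: "('v, 'k) mpoly" assume f: "pvar i * f \<in> graded_kernel n"
    have "coeff_sum (top_monomials n s) f = 0" for s
    proof (cases "top_monomials n s = {}")
      case False
      then obtain k where k: "k \<in> top_monomials n s" by blast
      then have "Poly_Mapping.single i 1 + k \<in> top_monomials n (s + n i)"
        using C by (auto simp: top_monomials_def)
      from vimage_top_monomials(2)[OF this]
      have "(+) (Poly_Mapping.single i 1) -` top_monomials n (s + n i) = top_monomials n s" by simp
      then show ?thesis
        using f coeff_sum_single_times[of "top_monomials n (s + n i)" "Poly_Mapping.single i 1" 1 f]
        by (simp add: graded_kernel_def pvar_def)
    qed simp
    then show "f \<in> graded_kernel n" by (simp add: graded_kernel_def)
  qed
qed

text \<open>
  The grading by weight is positive, so the part of lowest weight of \<open>y\<close> outside the ideal would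
  survive in \<open>u y\<close>, multiplied by the constant term of \<open>u\<close>.
\<close>

lemma unit_constant_term_regular:
  fixes u y :: "('v, 'k::field) mpoly"
  assumes u: "Poly_Mapping.lookup u 0 \<noteq> 0" and uy: "u * y \<in> graded_kernel n"
  shows "y \<in> graded_kernel n"
proof -
  have "coeff_sum (top_monomials n s) y = 0" for s
  proof (induct s rule: less_induct)
    case (less s)
    let ?K = "Poly_Mapping.keys u"
    have van: "coeff_sum ((+) m -` top_monomials n s) y = 0" if "m \<noteq> 0" for m
      using vimage_top_monomials_cases[of m s]
    proof
      assume "weight n m \<le> s \<and> (+) m -` top_monomials n s = top_monomials n (s - weight n m)"
      moreover have "0 < weight n m" using that weight_eq_0_iff[of m] by simp
      ultimately show ?thesis using less[of "s - weight n m"] by simp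
    qed simp
    have "0 = coeff_sum (top_monomials n s) (u * y)" using uy by (simp add: graded_kernel_def)
    also have "\<dots> = (\<Sum>m\<in>{0}. Poly_Mapping.lookup u m * coeff_sum ((+) m -` top_monomials n s) y)"
      unfolding coeff_sum_times
      by (rule sum.mono_neutral_right) (use u van in \<open>auto simp: in_keys_iff\<close>)
    also have "\<dots> = Poly_Mapping.lookup u 0 * coeff_sum (top_monomials n s) y"
      by (simp add: vimage_def)
    finally show ?case using u by simp
  qed
  then show ?thesis by (simp add: graded_kernel_def)
qed

end

section \<open>Quotient rings and restriction to an axis\<close>

text \<open>
  The ring of cosets of an ideal of a type ring, with \<open>q\<close> the projection, so that computations with
  cosets reduce to computations with representatives modulo \<open>J\<close>.
\<close>

locale type_quotient =
  fixes J :: "'a::comm_ring_1 set"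
  assumes ideal_J: "ideal J (ring_of_type_algebra :: 'a ring)"
begin

abbreviation Q where "Q \<equiv> (ring_of_type_algebra :: 'a ring) Quot J"

definition q :: "'a \<Rightarrow> 'a set" where
  "q f = J +>\<^bsub>(ring_of_type_algebra :: 'a ring)\<^esub> f"

lemma ring_hom_q: "ring_hom_ring (ring_of_type_algebra :: 'a ring) Q q"
  unfolding q_def[abs_def] by (rule ideal.rcos_ring_hom_ring[OF ideal_J])

lemma cring_Q: "cring Q"
  by (rule ideal.quotient_is_cring[OF ideal_J cring_from_type_algebra])

lemma carrier_Q: "carrier Q = range q"
  by (auto simp: FactRing_def A_RCOSETS_def' q_def)

lemma q_closed [simp]: "q f \<in> carrier Q"
  by (simp add: carrier_Q)

lemma q_mult [simp]: "q f \<otimes>\<^bsub>Q\<^esub> q g = q (f * g)"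
  using ring_hom_mult[OF ring_hom_ring.homh[OF ring_hom_q], of f g] by simp

lemma q_add [simp]: "q f \<oplus>\<^bsub>Q\<^esub> q g = q (f + g)"
  using ring_hom_add[OF ring_hom_ring.homh[OF ring_hom_q], of f g] by simp

lemma q_one: "\<one>\<^bsub>Q\<^esub> = q 1"
  using ring_hom_one[OF ring_hom_ring.homh[OF ring_hom_q]] by simp

lemma q_pow [simp]: "q f [^]\<^bsub>Q\<^esub> (k::nat) = q (f ^ k)"
proof -
  interpret Q: cring Q by (rule cring_Q)
  show ?thesis by (induct k) (simp_all add: q_one mult.commute)
qed

lemma q_eq_zero_iff: "q f = \<zero>\<^bsub>Q\<^esub> \<longleftrightarrow> f \<in> J"
proof -
  have "\<zero>\<^bsub>Q\<^esub> = J" by (simp add: FactRing_def)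
  then show ?thesis
    using ideal.rcos_const_imp_mem[OF ideal_J, of f] ring.a_rcos_zero[OF ring_from_type_algebra ideal_J, of f]
    by (auto simp: q_def)
qed

lemma q_eq_iff: "q f = q g \<longleftrightarrow> f - g \<in> J"
proof -
  interpret Q: cring Q by (rule cring_Q)
  have "q f = q (f - g) \<oplus>\<^bsub>Q\<^esub> q g" by simp
  then have "q f = q g \<longleftrightarrow> q (f - g) \<oplus>\<^bsub>Q\<^esub> q g = q g" by (simp only:)
  also have "\<dots> \<longleftrightarrow> q (f - g) = \<zero>\<^bsub>Q\<^esub>"
    by (rule Q.add.r_cancel_one) simp_all
  finally show ?thesis by (simp add: q_eq_zero_iff)
qed

lemma ideal_vimage_q:
  assumes "ideal M Q"
  shows "ideal {f. q f \<in> M} (ring_of_type_algebra :: 'a ring)"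
  using ring_hom_ring.ideal_vimage[OF ring_hom_q assms] by simp

lemma ideal_image_q:
  assumes N: "ideal N (ring_of_type_algebra :: 'a ring)"
  shows "ideal (q ` N) Q"
  using ring.ring_ideal_imp_quot_ideal[OF ring_from_type_algebra ideal_J N]
  by (simp add: q_def[abs_def])

lemma q_in_image_iff:
  assumes N: "ideal N (ring_of_type_algebra :: 'a ring)" "J \<subseteq> N"
  shows "q f \<in> q ` N \<longleftrightarrow> f \<in> N"
proof
  assume "q f \<in> q ` N"
  then obtain g where g: "g \<in> N" "f - g \<in> J" by (auto simp: q_eq_iff)
  then have "(f - g) + g \<in> N" using N unfolding type_ring_ideal_iff by blast
  then show "f \<in> N" by simp
qed simp

lemma noetherian_Q:
  assumes "noetherian_ring (ring_of_type_algebra :: 'a ring)"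
  shows "noetherian_ring Q"
proof (rule noetherian_ring_transfer[OF assms cring_Q ring_hom_ring.homh[OF ring_hom_q]])
  interpret Q: cring Q by (rule cring_Q)
  fix y assume y: "y \<in> carrier Q"
  then obtain f where "y = q f" by (auto simp: carrier_Q)
  then show "\<exists>a\<in>carrier (ring_of_type_algebra :: 'a ring). \<exists>x\<in>carrier Q. \<exists>z\<in>carrier Q.
      y = x \<otimes>\<^bsub>Q\<^esub> q a \<and> q a = z \<otimes>\<^bsub>Q\<^esub> y"
    by (intro bexI[of _ f] bexI[of _ "\<one>\<^bsub>Q\<^esub>"] conjI) (simp_all add: q_one)
qed

end

lemma (in cring) maximalideal_inverse_mod:
  assumes M: "maximalideal M R" and a: "a \<in> carrier R" "a \<notin> M"
  shows "\<exists>b\<in>carrier R. \<exists>m\<in>M. \<one> = a \<otimes> b \<oplus> m"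
proof -
  interpret M: maximalideal M R by fact
  have id: "ideal (PIdl a <+> M) R"
    by (rule add_ideals[OF cgenideal_ideal[OF a(1)] M.is_ideal])
  have memI: "c \<otimes> a \<oplus> m \<in> PIdl a <+> M" if "c \<in> carrier R" "m \<in> M" for c m
    using that by (auto simp: set_add_def' cgenideal_def)
  have "M \<subseteq> PIdl a <+> M"
  proof
    fix m assume m: "m \<in> M"
    then show "m \<in> PIdl a <+> M" using memI[of \<zero> m] a by simp
  qed
  moreover have "a \<in> PIdl a <+> M" using memI[of \<one> \<zero>] a by simp
  moreover have "PIdl a <+> M \<subseteq> carrier R"
    using ideal.Icarr[OF id] by auto
  ultimately have "PIdl a <+> M = carrier R"
    using M.I_maximal[OF id] a(2) by auto
  then have "\<one> \<in> PIdl a <+> M" by simp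
  then obtain c m where "c \<in> carrier R" "m \<in> M" "\<one> = c \<otimes> a \<oplus> m"
    by (auto simp: set_add_def' cgenideal_def)
  then show ?thesis using a m_comm[of c a] by auto
qed

lemma bezout_common_divisor:
  fixes a b :: "'a::euclidean_ring"
  shows "\<exists>g r s. g dvd a \<and> g dvd b \<and> g = r * a + s * b"
proof (induct "euclidean_size b" arbitrary: a b rule: less_induct)
  case less
  show ?case
  proof (cases "b = 0")
    case True
    then show ?thesis by (intro exI[of _ a] exI[of _ 1] exI[of _ 0]) simp
  next
    case False
    then obtain g r s where g: "g dvd b" "g dvd a mod b" "g = r * b + s * (a mod b)"
      using less[of "a mod b" b] mod_size_less[of b a] by blast
    have "g dvd a" using g(1,2) by (simp add: dvd_mod_iff)
    moreover have "g = s * a + (r - s * (a div b)) * b"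
      using g(3) by (simp add: minus_mult_div_eq_mod[symmetric] algebra_simps)
    ultimately show ?thesis using g(1) by blast
  qed
qed

text \<open>
  Dividing \<open>F\<close> by its common divisors with \<open>H\<close> until none is left splits it into a divisor of a power
  of \<open>H\<close> and a factor \<open>U\<close> that is coprime to \<open>H\<close>. This is how the one-dimensionality of \<open>K[x]\<close> enters:
  modulo a maximal ideal that contains \<open>H\<close>, the factor \<open>U\<close> is invertible.
\<close>

lemma poly_coprime_part:
  fixes F H :: "'k::field poly"
  assumes "F \<noteq> 0"
  shows "\<exists>k U W r s. H ^ k * U = F * W \<and> r * U + s * H = 1"
  using assms
proof (induct "degree F" arbitrary: F rule: less_induct)
  case less
  obtain g r s where g: "g dvd F" "g dvd H" "g = r * F + s * H"
    using bezout_common_divisor by blast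
  obtain F' where F': "F = g * F'" using g(1) by blast
  obtain H' where H': "H = g * H'" using g(2) by blast
  have nz: "g \<noteq> 0" "F' \<noteq> 0" using less(2) F' by auto
  show ?case
  proof (cases "degree g = 0")
    case True
    then have "is_unit g" using nz by (simp add: is_unit_iff_degree)
    then obtain u where "1 = g * u" by (elim dvdE)
    then have "(u * r) * F + (u * s) * H = 1"
      using g(3) by (simp add: algebra_simps)
    moreover have "H ^ 0 * F = F * 1" by simp
    ultimately show ?thesis by blast
  next
    case False
    then have "degree F' < degree F" using nz unfolding F' by (simp add: degree_mult_eq)
    from less(1)[OF this nz(2)] obtain k U W a b
      where kU: "H ^ k * U = F' * W" "a * U + b * H = 1" by blast
    have "H ^ Suc k * U = H * (F' * W)" by (simp add: kU(1)[symmetric] mult.assoc)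
    also have "\<dots> = F * (H' * W)" by (simp add: F' H' algebra_simps)
    finally show ?thesis using kU(2) by blast
  qed
qed

text \<open>
  The restriction of \<open>f\<close> to the \<open>i\<close>-th coordinate axis, that is, \<open>f\<close> with all other variables set to
  \<open>0\<close>. The next definition is its section.
\<close>

definition axis_poly :: "'v \<Rightarrow> ('v, 'k::comm_ring_1) mpoly \<Rightarrow> 'k poly" where
  "axis_poly i f = Abs_poly (\<lambda>k. Poly_Mapping.lookup f (Poly_Mapping.single i k))"

definition axis_lift :: "'v \<Rightarrow> 'k::comm_ring_1 poly \<Rightarrow> ('v, 'k) mpoly" where
  "axis_lift i p = (\<Sum>k\<le>degree p. Poly_Mapping.single (Poly_Mapping.single i k) (coeff p k))"

lemma single_inject_nat [simp]: "Poly_Mapping.single i (a::nat) = Poly_Mapping.single i b \<longleftrightarrow> a = b"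
  by (metis lookup_single_eq)

lemma coeff_axis_poly [simp]:
  "coeff (axis_poly i f) k = Poly_Mapping.lookup f (Poly_Mapping.single i k)"
proof -
  have "finite ((\<lambda>k. Poly_Mapping.single i k) -` Poly_Mapping.keys f)"
    by (rule finite_vimageI) (auto intro: injI)
  then have "\<forall>\<^sub>\<infinity>k. Poly_Mapping.lookup f (Poly_Mapping.single i k) = 0"
    by (auto simp: MOST_iff_cofinite vimage_def in_keys_iff)
  then show ?thesis by (simp add: axis_poly_def Abs_poly_inverse)
qed

lemma axis_poly_add: "axis_poly i (f + g) = axis_poly i f + axis_poly i g"
  by (rule poly_eqI) (simp add: lookup_add)

lemma axis_poly_diff: "axis_poly i (f - g) = axis_poly i f - axis_poly i g"
  by (rule poly_eqI) (simp add: lookup_minus)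

lemma axis_poly_zero [simp]: "axis_poly i 0 = 0"
  by (rule poly_eqI) simp

lemma axis_poly_sum: "axis_poly i (sum g A) = (\<Sum>x\<in>A. axis_poly i (g x))"
  by (induct A rule: infinite_finite_induct) (simp_all add: axis_poly_add)

lemma axis_poly_single:
  "axis_poly i (Poly_Mapping.single m c) =
    (if m \<in> range (Poly_Mapping.single i) then monom c (Poly_Mapping.lookup m i) else 0)"
  by (rule poly_eqI) (auto simp: lookup_single when_def)

lemma axis_poly_one [simp]: "axis_poly i 1 = 1"
proof (rule poly_eqI)
  fix k :: nat
  have "Poly_Mapping.single i k = 0 \<longleftrightarrow> k = 0"
    using single_inject_nat[of i k 0] by (simp del: single_inject_nat)
  then show "coeff (axis_poly i 1) k = coeff 1 k"
    by (simp add: lookup_one when_def)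
qed

lemma single_eq_add_imp:
  fixes m x :: "'v \<Rightarrow>\<^sub>0 nat"
  assumes "Poly_Mapping.single i k = m + x"
  shows "m = Poly_Mapping.single i (Poly_Mapping.lookup m i)" "Poly_Mapping.lookup m i \<le> k"
    "x = Poly_Mapping.single i (k - Poly_Mapping.lookup m i)"
proof -
  have L: "Poly_Mapping.lookup (Poly_Mapping.single i k) j = Poly_Mapping.lookup m j + Poly_Mapping.lookup x j" for j
    using assms by (simp add: lookup_add)
  show "m = Poly_Mapping.single i (Poly_Mapping.lookup m i)"
  proof (rule poly_mapping_eqI)
    fix j show "Poly_Mapping.lookup m j = Poly_Mapping.lookup (Poly_Mapping.single i (Poly_Mapping.lookup m i)) j"
      using L[of j] by (cases "i = j") (auto simp: lookup_single)
  qed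
  show "Poly_Mapping.lookup m i \<le> k" using L[of i] by simp
  show "x = Poly_Mapping.single i (k - Poly_Mapping.lookup m i)"
  proof (rule poly_mapping_eqI)
    fix j show "Poly_Mapping.lookup x j = Poly_Mapping.lookup (Poly_Mapping.single i (k - Poly_Mapping.lookup m i)) j"
      using L[of j] by (cases "i = j") (auto simp: lookup_single)
  qed
qed

lemma axis_poly_single_times:
  "axis_poly i (Poly_Mapping.single m c * f) = axis_poly i (Poly_Mapping.single m c) * axis_poly i f"
proof (rule poly_eqI)
  fix k
  let ?g = "Poly_Mapping.single m c * f"
  show "coeff (axis_poly i ?g) k = coeff (axis_poly i (Poly_Mapping.single m c) * axis_poly i f) k"
  proof (cases "\<exists>x. Poly_Mapping.single i k = m + x")
    case True
    then obtain x where x: "Poly_Mapping.single i k = m + x" by blast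
    note * = single_eq_add_imp[OF x]
    then have "m \<in> range (Poly_Mapping.single i)" by (metis rangeI)
    moreover have "coeff (axis_poly i ?g) k = c * Poly_Mapping.lookup f x"
      by (simp add: x lookup_single_times)
    ultimately show ?thesis using *(2) *(3)[symmetric]
      by (simp add: axis_poly_single coeff_monom_mult)
  next
    case False
    then have "coeff (axis_poly i ?g) k = 0"
      using keys_single_times[of m c f] by (auto simp: in_keys_iff)
    moreover have "k < Poly_Mapping.lookup m i" if "m = Poly_Mapping.single i a" for a
    proof (rule ccontr)
      assume "\<not> k < Poly_Mapping.lookup m i"
      then have "Poly_Mapping.single i k = m + Poly_Mapping.single i (k - a)"
        by (simp add: that single_add[symmetric])
      then show False using False by blast
    qed
    ultimately show ?thesis by (auto simp: axis_poly_single coeff_monom_mult)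
  qed
qed

lemma axis_poly_mult: "axis_poly i (f * g) = axis_poly i f * axis_poly i g"
proof -
  let ?s = "\<lambda>m. Poly_Mapping.single m (Poly_Mapping.lookup f m)"
  have "f * g = (\<Sum>m\<in>Poly_Mapping.keys f. ?s m * g)"
    by (subst poly_mapping_sum_singles[of f]) (rule sum_distrib_right)
  then have "axis_poly i (f * g) = axis_poly i (\<Sum>m\<in>Poly_Mapping.keys f. ?s m) * axis_poly i g"
    by (simp add: axis_poly_sum axis_poly_single_times sum_distrib_right)
  then show ?thesis by (simp add: poly_mapping_sum_singles[symmetric])
qed

lemma axis_poly_power: "axis_poly i (f ^ k) = axis_poly i f ^ k"
  by (induct k) (simp_all add: axis_poly_mult)

lemma axis_poly_lift [simp]: "axis_poly i (axis_lift i p) = p"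
  by (simp add: axis_lift_def axis_poly_sum axis_poly_single poly_as_sum_of_monoms)

text \<open>
  In the binomial expansion each term has \<open>a\<close> factors \<open>f\<close> or \<open>b\<close> factors \<open>g\<close>.
\<close>

lemma radical_add:
  fixes I :: "'a::comm_ring_1 set"
  assumes I: "ideal I ring_of_type_algebra" and f: "f ^ a \<in> I" and g: "g ^ b \<in> I"
  shows "(f + g) ^ (a + b) \<in> I"
  unfolding binomial_ring
proof (rule type_ring_ideal_sum[OF I])
  have mult: "r * x \<in> I" "x * r \<in> I" if "x \<in> I" for x r
    using I that unfolding type_ring_ideal_iff by (auto simp: mult.commute[of x r])
  fix k assume "k \<in> {..a + b}"
  show "of_nat (a + b choose k) * f ^ k * g ^ (a + b - k) \<in> I"
  proof (cases "a \<le> k")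
    case True
    then have "f ^ k = f ^ (k - a) * f ^ a" by (simp add: power_add[symmetric])
    then show ?thesis using mult f by simp
  next
    case False
    then have "g ^ (a + b - k) = g ^ (a - k) * g ^ b" by (simp add: power_add[symmetric])
    then show ?thesis using mult g by simp
  qed
qed

lemma radical_sum:
  fixes I :: "'a::comm_ring_1 set"
  assumes I: "ideal I ring_of_type_algebra" and "\<And>x. x \<in> A \<Longrightarrow> \<exists>k::nat. g x ^ k \<in> I"
  shows "\<exists>k::nat. (sum g A) ^ k \<in> I"
  using assms(2)
proof (induct A rule: infinite_finite_induct)
  case (insert x A)
  then obtain a b where "g x ^ a \<in> I" "(sum g A) ^ b \<in> I" by blast
  from radical_add[OF I this] show ?case using insert by auto
qed (use I in \<open>auto simp: type_ring_ideal_iff intro: exI[of _ 1]\<close>)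

lemma power_cong_mod:
  fixes a b :: "'a::comm_ring_1"
  shows "\<exists>c. a ^ N = (a - b) ^ N + b * c"
proof (induct N)
  case (Suc N)
  then obtain c where c: "a ^ N = (a - b) ^ N + b * c" by blast
  have "a ^ Suc N = (a - b) ^ Suc N + b * ((a - b) ^ N + a * c)"
    by (simp add: c algebra_simps)
  then show ?case by blast
qed (auto intro: exI[of _ 0])

section \<open>Cohen-Macaulayness of the tangent cone\<close>

lemma single_power:
  "(Poly_Mapping.single m c :: ('v, 'k::comm_ring_1) mpoly) ^ k = Poly_Mapping.single (\<Sum>j<k. m) (c ^ k)"
  by (induct k) (simp_all add: mult_single add.commute)

locale least_weight = positive_weights n for n :: "'v::{finite,linorder} \<Rightarrow> nat" +
  fixes i :: 'v
  assumes least: "j \<noteq> i \<Longrightarrow> n i < n j"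
begin

lemma degree_le_weight: "n i * total_degree m \<le> weight n m"
  unfolding total_degree_def weight_def sum_distrib_left
proof (rule sum_mono)
  fix j show "n i * Poly_Mapping.lookup m j \<le> n j * Poly_Mapping.lookup m j"
    using least[of j] by (cases "j = i") auto
qed

text \<open>
  Replacing every variable by \<open>x\<^sub>i\<close> keeps the degree and lowers the weight, since \<open>n i\<close> is the smallest.
\<close>

lemma degree_less_weight:
  assumes "m \<notin> range (Poly_Mapping.single i)"
  shows "n i * total_degree m < weight n m"
proof -
  have "\<exists>j. j \<noteq> i \<and> 0 < Poly_Mapping.lookup m j"
  proof (rule ccontr)
    assume none: "\<not> ?thesis"
    have "m = Poly_Mapping.single i (Poly_Mapping.lookup m i)"
    proof (rule poly_mapping_eqI)
      fix j show "Poly_Mapping.lookup m j = Poly_Mapping.lookup (Poly_Mapping.single i (Poly_Mapping.lookup m i)) j"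
        using none by (cases "j = i") (auto simp: lookup_single)
    qed
    then show False using assms by (metis rangeI)
  qed
  then obtain j where j: "j \<noteq> i" "0 < Poly_Mapping.lookup m j" by blast
  show ?thesis
    unfolding total_degree_def weight_def sum_distrib_left
  proof (rule sum_strict_mono_ex1)
    show "\<forall>x\<in>UNIV. n i * Poly_Mapping.lookup m x \<le> n x * Poly_Mapping.lookup m x"
    proof
      fix x show "n i * Poly_Mapping.lookup m x \<le> n x * Poly_Mapping.lookup m x"
        using least[of x] by (cases "x = i") auto
    qed
    show "\<exists>x\<in>UNIV. n i * Poly_Mapping.lookup m x < n x * Poly_Mapping.lookup m x"
      using j least[of j] by (intro bexI[of _ j]) auto
  qed simp
qed

lemma top_monomials_axis: "top_monomials n (n i * k) = {Poly_Mapping.single i k}"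
proof -
  have w: "weight n (Poly_Mapping.single i k) = n i * k" by simp
  have "k \<le> max_degree n (n i * k)"
    using total_degree_le_max[of "Poly_Mapping.single i k"] by simp
  moreover obtain m where "m \<in> top_monomials n (n i * k)"
    using top_monomials_nonempty[of "Poly_Mapping.single i k"] by auto
  then have "max_degree n (n i * k) \<le> k"
    using degree_le_weight[of m] pos[of i] by (simp add: top_monomials_def)
  ultimately have max: "max_degree n (n i * k) = k" by simp
  have "m = Poly_Mapping.single i k" if "m \<in> top_monomials n (n i * k)" for m
  proof (cases "m \<in> range (Poly_Mapping.single i)")
    case True
    then show ?thesis using that max by (auto simp: top_monomials_def)
  next
    case False
    then show ?thesis using degree_less_weight[of m] that max by (simp add: top_monomials_def)
  qed
  moreover have "Poly_Mapping.single i k \<in> top_monomials n (n i * k)"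
    by (simp add: top_monomials_def max)
  ultimately show ?thesis by blast
qed

lemma graded_kernel_axis:
  assumes "f \<in> graded_kernel n"
  shows "axis_poly i f = 0" "Poly_Mapping.lookup f 0 = 0"
proof -
  have *: "Poly_Mapping.lookup f (Poly_Mapping.single i k) = 0" for k
  proof -
    have "coeff_sum (top_monomials n (n i * k)) f = 0"
      using assms unfolding graded_kernel_def by blast
    then have "coeff_sum {Poly_Mapping.single i k} f = 0"
      unfolding top_monomials_axis .
    then show ?thesis by (cases "Poly_Mapping.single i k \<in> Poly_Mapping.keys f")
      (simp_all add: coeff_sum_def in_keys_iff)
  qed
  show "axis_poly i f = 0" by (rule poly_eqI) (simp add: *)
  show "Poly_Mapping.lookup f 0 = 0" using *[of 0] by (simp only: single_zero)
qed

text \<open>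
  The power \<open>m\<^bsup>n i\<^esup>\<close> has the weight of \<open>x\<^sub>i\<close> to the power \<open>weight n m\<close>, and a smaller degree.
\<close>

lemma off_axis_monomial_nilpotent:
  assumes "m \<notin> range (Poly_Mapping.single i)"
  shows "(Poly_Mapping.single m c :: ('v, 'k::comm_ring_1) mpoly) ^ (n i) \<in> graded_kernel n"
proof -
  let ?M = "\<Sum>j<n i. m"
  have w: "weight n (\<Sum>j<(k::nat). m) = k * weight n m" for k by (induct k) simp_all
  have d: "total_degree (\<Sum>j<(k::nat). m) = k * total_degree m" for k
    by (induct k) (simp add: total_degree_def, simp)
  have "total_degree ?M < max_degree n (weight n ?M)"
    using degree_less_weight[OF assms] total_degree_le_max[of "Poly_Mapping.single i (weight n m)"]
    by (simp add: w d)
  then have "?M \<notin> top_monomials n s" for s by (auto simp: top_monomials_def)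
  then show ?thesis unfolding single_power graded_kernel_def by simp
qed

lemma axis_zero_imp_nilpotent:
  fixes f :: "('v, 'k::comm_ring_1) mpoly"
  assumes "axis_poly i f = 0"
  shows "\<exists>k::nat. f ^ k \<in> graded_kernel n"
proof -
  have "\<exists>k::nat. Poly_Mapping.single m (Poly_Mapping.lookup f m) ^ k \<in> (graded_kernel n :: ('v, 'k) mpoly set)"
    if m: "m \<in> Poly_Mapping.keys f" for m
  proof -
    have "m \<notin> range (Poly_Mapping.single i)"
    proof
      assume "m \<in> range (Poly_Mapping.single i)"
      then obtain k where "m = Poly_Mapping.single i k" by blast
      then have "Poly_Mapping.lookup f m = coeff (axis_poly i f) k" by simp
      then show False using m assms by (simp add: in_keys_iff)
    qed
    from off_axis_monomial_nilpotent[OF this] show ?thesis by blast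
  qed
  then have "\<exists>k::nat. (\<Sum>m\<in>Poly_Mapping.keys f. Poly_Mapping.single m (Poly_Mapping.lookup f m)) ^ k \<in> graded_kernel n"
    by (rule radical_sum[OF ideal_graded_kernel])
  then show ?thesis by (simp only: poly_mapping_sum_singles[symmetric])
qed

end

text \<open>
  The coordinate ring of the tangent cone. By the last lemma its reduction is the polynomial ring
  in \<open>x\<^sub>i\<close>: the tangent cone is a possibly thickened line. The ideal called \<open>vertex\<close> is that of the
  origin.
\<close>

locale tangent_cone = least_weight n i for n :: "'v::{finite,linorder} \<Rightarrow> nat" and i +
  fixes J :: "('v, 'k::field) mpoly set"
  assumes J_def: "J = graded_kernel n"

sublocale tangent_cone \<subseteq> type_quotient J
  by (rule type_quotient.intro) (simp add: J_def ideal_graded_kernel)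

context tangent_cone
begin

lemma J_closed: "f \<in> J \<Longrightarrow> g \<in> J \<Longrightarrow> f + g \<in> J" "f \<in> J \<Longrightarrow> r * f \<in> J"
  using ideal_J unfolding type_ring_ideal_iff by auto

lemma constant_term_mult:
  "Poly_Mapping.lookup (r * f) 0 = Poly_Mapping.lookup r 0 * Poly_Mapping.lookup (f :: ('v, 'k) mpoly) 0"
proof -
  have "coeff (axis_poly i (r * f)) 0 = coeff (axis_poly i r) 0 * coeff (axis_poly i f) 0"
    by (simp only: axis_poly_mult coeff_mult_0)
  then show ?thesis by (simp only: coeff_axis_poly single_zero)
qed

lemma cancel_unit_constant_term:
  "Poly_Mapping.lookup u 0 \<noteq> 0 \<Longrightarrow> u * y \<in> J \<Longrightarrow> y \<in> J"
  unfolding J_def by (rule unit_constant_term_regular)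

lemma axis_zero_imp_power_in_J: "axis_poly i f = 0 \<Longrightarrow> \<exists>k::nat. f ^ k \<in> J"
  unfolding J_def by (rule axis_zero_imp_nilpotent)

definition nilradical :: "('v, 'k) mpoly set set" where
  "nilradical = q ` {f. axis_poly i f = 0}"

definition vertex :: "('v, 'k) mpoly set set" where
  "vertex = q ` {f. Poly_Mapping.lookup f 0 = 0}"

lemma ideal_axis_kernel:
  "ideal {f :: ('v, 'k) mpoly. axis_poly i f = 0} mpoly_ring" "J \<subseteq> {f. axis_poly i f = 0}"
  using graded_kernel_axis(1)
  by (auto simp: J_def type_ring_ideal_iff axis_poly_add axis_poly_mult)

lemma ideal_constant_free:
  "ideal {f :: ('v, 'k) mpoly. Poly_Mapping.lookup f 0 = 0} mpoly_ring" "J \<subseteq> {f. Poly_Mapping.lookup f 0 = 0}"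
  using graded_kernel_axis(2)
  by (auto simp: J_def type_ring_ideal_iff lookup_add constant_term_mult)

lemma q_in_nilradical_iff: "q f \<in> nilradical \<longleftrightarrow> axis_poly i f = 0"
  unfolding nilradical_def by (subst q_in_image_iff[OF ideal_axis_kernel]) simp

lemma q_in_vertex_iff: "q f \<in> vertex \<longleftrightarrow> Poly_Mapping.lookup f 0 = 0"
  unfolding vertex_def by (subst q_in_image_iff[OF ideal_constant_free]) simp

lemma constant_term_pvar: "Poly_Mapping.lookup (pvar i :: ('v, 'k) mpoly) 0 = 0"
proof -
  have "Poly_Mapping.single i (1::nat) \<noteq> 0"
    using single_inject_nat[of i 1 0] by (simp del: single_inject_nat)
  then show ?thesis by (simp add: pvar_def lookup_single when_def)
qed

lemma axis_poly_pvar: "axis_poly i (pvar i :: ('v, 'k) mpoly) \<noteq> 0"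
  by (simp add: pvar_def axis_poly_single)

text \<open>
  A polynomial with nonzero constant term becomes a unit after a subtraction of a polynomial
  without constant term.
\<close>

lemma maximalideal_vertex: "maximalideal vertex Q"
proof (rule maximalidealI)
  show id: "ideal vertex Q"
    unfolding vertex_def by (rule ideal_image_q[OF ideal_constant_free(1)])
  have "q 1 \<notin> vertex" by (simp add: q_in_vertex_iff)
  then show "carrier Q \<noteq> vertex" using q_closed by blast
  fix M assume M: "ideal M Q" "vertex \<subseteq> M" "M \<subseteq> carrier Q"
  show "M = vertex \<or> M = carrier Q"
  proof (rule disjCI)
    assume proper: "M \<noteq> carrier Q"
    have "x \<in> vertex" if x: "x \<in> M" for x
    proof (rule ccontr)
      assume "x \<notin> vertex"
      obtain f where f: "x = q f" using x M(3) by (auto simp: carrier_Q)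
      let ?c = "Poly_Mapping.lookup f 0"
      have c: "?c \<noteq> 0" using \<open>x \<notin> vertex\<close> by (simp add: f q_in_vertex_iff)
      let ?s = "Poly_Mapping.single 0 :: 'k \<Rightarrow> ('v, 'k) mpoly"
      have "q (f - ?s ?c) \<in> M"
        using M(2) q_in_vertex_iff[of "f - ?s ?c"] by (auto simp: lookup_minus)
      with ideal_vimage_q[OF M(1)] x
      have "?s (inverse ?c) * ((- 1) * (f - ?s ?c) + f) \<in> {f. q f \<in> M}"
        unfolding type_ring_ideal_iff f by blast
      moreover have "?s (inverse ?c) * ((- 1) * (f - ?s ?c) + f) = 1"
        using c by (simp add: mult_single)
      ultimately have "\<one>\<^bsub>Q\<^esub> \<in> M" by (simp add: q_one)
      then show False using ideal.one_imp_carrier[OF M(1)] proper by simp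
    qed
    then show "M = vertex" using M(2) by blast
  qed
qed

lemma primeideal_nilradical: "primeideal nilradical Q"
proof (rule primeidealI[OF _ cring_Q])
  show "ideal nilradical Q"
    unfolding nilradical_def by (rule ideal_image_q[OF ideal_axis_kernel(1)])
  have "q 1 \<notin> nilradical" by (simp add: q_in_nilradical_iff)
  then show "carrier Q \<noteq> nilradical" using q_closed by blast
  fix a b assume "a \<in> carrier Q" "b \<in> carrier Q" "a \<otimes>\<^bsub>Q\<^esub> b \<in> nilradical"
  then show "a \<in> nilradical \<or> b \<in> nilradical"
    by (auto simp: carrier_Q q_in_nilradical_iff axis_poly_mult)
qed

lemma nilradical_nilpotent:
  assumes "p \<in> nilradical"
  shows "\<exists>k::nat. p [^]\<^bsub>Q\<^esub> k = \<zero>\<^bsub>Q\<^esub>"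
proof -
  obtain f where f: "p = q f" "axis_poly i f = 0"
    using assms unfolding nilradical_def by blast
  from axis_zero_imp_power_in_J[OF f(2)] show ?thesis by (auto simp: f(1) q_eq_zero_iff)
qed

lemma not_maximalideal_nilradical: "\<not> maximalideal nilradical Q"
proof
  assume "maximalideal nilradical Q"
  then interpret PM: maximalideal nilradical Q .
  interpret MM: maximalideal vertex Q by (rule maximalideal_vertex)
  have "nilradical \<subseteq> vertex"
  proof
    fix p assume "p \<in> nilradical"
    then obtain f where f: "p = q f" "axis_poly i f = 0" unfolding nilradical_def by blast
    have "coeff (axis_poly i f) 0 = 0" using f(2) by simp
    then show "p \<in> vertex" by (simp only: f(1) q_in_vertex_iff coeff_axis_poly single_zero)
  qed
  moreover have "vertex \<noteq> nilradical"
    using constant_term_pvar axis_poly_pvar q_in_vertex_iff[of "pvar i"] q_in_nilradical_iff[of "pvar i"]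
    by auto
  ultimately show False using PM.I_maximal[OF MM.is_ideal _ MM.a_subset] MM.I_notcarr by auto
qed

lemma axis_zero_imp_in_maximal:
  assumes M: "maximalideal M Q" and f: "axis_poly i f = 0"
  shows "q f \<in> M"
proof -
  obtain k :: nat where k: "f ^ k \<in> J" using axis_zero_imp_power_in_J[OF f] by blast
  interpret MP: primeideal M Q by (rule cring.maximalideal_prime[OF cring_Q M])
  have "q f [^]\<^bsub>Q\<^esub> k = \<zero>\<^bsub>Q\<^esub>" using k by (simp only: q_pow q_eq_zero_iff)
  with additive_subgroup.zero_closed[OF MP.is_additive_subgroup]
  have "q f [^]\<^bsub>Q\<^esub> k \<in> M" by (rule back_subst[where P = "\<lambda>x. x \<in> M", OF _ sym])
  then show "q f \<in> M" by (rule MP.pow_in_prime[OF q_closed])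
qed

text \<open>
  The splitting of one-variable polynomials, applied to the restrictions of \<open>f\<close> and \<open>h\<close> to the axis
  and lifted back. The identities hold up to nilpotents: raising the first one to a power
  removes its error term, and the error term of the second one lies in every maximal ideal.
\<close>

lemma power_times_unit_in_principal:
  assumes M: "maximalideal M Q" and f: "f \<in> carrier Q - nilradical" and h: "h \<in> M"
  shows "\<exists>k::nat. \<exists>u\<in>carrier Q - M. \<exists>w\<in>carrier Q. h [^]\<^bsub>Q\<^esub> k \<otimes>\<^bsub>Q\<^esub> u = f \<otimes>\<^bsub>Q\<^esub> w"
proof -
  interpret MM: maximalideal M Q by (rule M)
  interpret MP: primeideal M Q by (rule cring.maximalideal_prime[OF cring_Q M])
  obtain f' where f': "f = q f'" "axis_poly i f' \<noteq> 0"
    using f by (auto simp: carrier_Q q_in_nilradical_iff)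
  obtain h' where h': "h = q h'" using MM.Icarr[OF h] by (auto simp: carrier_Q)
  obtain k U W r s where poly: "axis_poly i h' ^ k * U = axis_poly i f' * W"
    "r * U + s * axis_poly i h' = 1"
    using poly_coprime_part[OF f'(2)] by blast
  let ?l = "axis_lift i :: 'k poly \<Rightarrow> ('v, 'k) mpoly"
  have "axis_poly i (h' ^ k * ?l U - f' * ?l W) = 0"
    using poly(1) by (simp add: axis_poly_diff axis_poly_mult axis_poly_power)
  then obtain N :: nat where N: "(h' ^ k * ?l U - f' * ?l W) ^ N \<in> J"
    using axis_zero_imp_power_in_J by blast
  obtain c where c: "(h' ^ k * ?l U) ^ N = (h' ^ k * ?l U - f' * ?l W) ^ N + f' * ?l W * c"
    using power_cong_mod by blast
  have "h' ^ (k * N) * ?l U ^ N = (h' ^ k * ?l U) ^ N"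
    by (simp only: power_mult_distrib power_mult)
  then have "h' ^ (k * N) * ?l U ^ N - f' * (?l W * c) = (h' ^ k * ?l U - f' * ?l W) ^ N"
    unfolding c by (simp only: mult.assoc add_diff_cancel_right')
  then have "q (h' ^ (k * N) * ?l U ^ N) = q (f' * (?l W * c))"
    unfolding q_eq_iff using N by (simp only:)
  then have "h [^]\<^bsub>Q\<^esub> (k * N) \<otimes>\<^bsub>Q\<^esub> q (?l U ^ N) = f \<otimes>\<^bsub>Q\<^esub> q (?l W * c)"
    by (simp only: f'(1) h' q_pow q_mult)
  moreover have "q (?l U ^ N) \<notin> M"
  proof
    assume "q (?l U ^ N) \<in> M"
    then have "q (?l U) [^]\<^bsub>Q\<^esub> N \<in> M" by simp
    then have U: "q (?l U) \<in> M" by (rule MP.pow_in_prime[OF q_closed])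
    let ?b = "?l r * ?l U + ?l s * h'"
    have "axis_poly i (1 - ?b) = 0"
      using poly(2) by (simp add: axis_poly_diff axis_poly_add axis_poly_mult)
    then have "q (1 - ?b) \<in> M" by (rule axis_zero_imp_in_maximal[OF M])
    moreover have "q (?l r) \<otimes>\<^bsub>Q\<^esub> q (?l U) \<in> M" "q (?l s) \<otimes>\<^bsub>Q\<^esub> q h' \<in> M"
      by (rule MM.I_l_closed[OF U q_closed], rule MM.I_l_closed[OF h[unfolded h'] q_closed])
    then have "q (?l r) \<otimes>\<^bsub>Q\<^esub> q (?l U) \<oplus>\<^bsub>Q\<^esub> q (?l s) \<otimes>\<^bsub>Q\<^esub> q h' \<in> M"
      by (rule additive_subgroup.a_closed[OF MM.is_additive_subgroup])
    then have "q ?b \<in> M" by (simp only: q_mult q_add)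
    ultimately have "q (1 - ?b) \<oplus>\<^bsub>Q\<^esub> q ?b \<in> M"
      by (rule additive_subgroup.a_closed[OF MM.is_additive_subgroup])
    moreover have "q (1 - ?b) \<oplus>\<^bsub>Q\<^esub> q ?b = \<one>\<^bsub>Q\<^esub>" by (simp only: q_add q_one diff_add_cancel)
    ultimately have "\<one>\<^bsub>Q\<^esub> \<in> M" by (rule back_subst)
    then show False using MM.one_imp_carrier MM.I_notcarr by simp
  qed
  ultimately show ?thesis using q_closed by blast
qed

text \<open>
  A maximal ideal that does not contain \<open>x\<^sub>i\<close> contains the class of some \<open>1 - x\<^sub>i b\<close>, which is
  a nonzerodivisor because its constant term is \<open>1\<close>.
\<close>

lemma regular_in_maximal:
  assumes xreg: "\<And>f. pvar i * f \<in> J \<Longrightarrow> f \<in> J" and M: "maximalideal M Q"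
  shows "\<exists>a. q a \<in> M \<and> (\<forall>y. a * y \<in> J \<longrightarrow> y \<in> J)"
proof (cases "q (pvar i) \<in> M")
  case True
  then show ?thesis using xreg by blast
next
  case False
  interpret MM: maximalideal M Q by (rule M)
  obtain b m where bm: "b \<in> carrier Q" "m \<in> M" "\<one>\<^bsub>Q\<^esub> = q (pvar i) \<otimes>\<^bsub>Q\<^esub> b \<oplus>\<^bsub>Q\<^esub> m"
    using cring.maximalideal_inverse_mod[OF cring_Q M q_closed False] by (elim bexE)
  obtain b' where b': "b = q b'" using bm(1) unfolding carrier_Q by (rule rangeE)
  obtain m' where m': "m = q m'" using MM.Icarr[OF bm(2)] unfolding carrier_Q by (rule rangeE)
  have "q 1 = q (pvar i * b' + m')" using bm(3) by (simp only: b' m' q_one q_mult q_add)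
  then have "1 - (pvar i * b' + m') \<in> J" by (rule q_eq_iff[THEN iffD1])
  then have "1 - pvar i * b' - m' \<in> J" by (simp only: diff_diff_eq)
  then have "q (1 - pvar i * b') = q m'" by (rule q_eq_iff[THEN iffD2])
  then have "q (1 - pvar i * b') \<in> M" using bm(2) m' by simp
  moreover have "Poly_Mapping.lookup (1 - pvar i * b') 0 \<noteq> 0"
    by (simp add: lookup_minus constant_term_mult constant_term_pvar)
  ultimately show ?thesis using cancel_unit_constant_term by blast
qed

text \<open>
  The class \<open>a\<close> becomes a nonzerodivisor in the localization at \<open>M\<close>.
\<close>

definition locally_regular :: "('v, 'k) mpoly set set \<Rightarrow> ('v, 'k) mpoly set \<Rightarrow> bool" where
  "locally_regular M a \<longleftrightarrow> (\<forall>y\<in>carrier Q. (\<exists>u\<in>carrier Q - M. u \<otimes>\<^bsub>Q\<^esub> (a \<otimes>\<^bsub>Q\<^esub> y) = \<zero>\<^bsub>Q\<^esub>) \<longrightarrow>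
    (\<exists>u\<in>carrier Q - M. u \<otimes>\<^bsub>Q\<^esub> y = \<zero>\<^bsub>Q\<^esub>))"

lemma locally_regular_iff:
  "locally_regular M (q a) \<longleftrightarrow>
    (\<forall>y. (\<exists>u. q u \<notin> M \<and> u * (a * y) \<in> J) \<longrightarrow> (\<exists>u. q u \<notin> M \<and> u * y \<in> J))"
proof -
  have *: "(\<exists>u\<in>carrier Q - M. u \<otimes>\<^bsub>Q\<^esub> q z = \<zero>\<^bsub>Q\<^esub>) \<longleftrightarrow> (\<exists>u. q u \<notin> M \<and> u * z \<in> J)" for z
  proof
    assume "\<exists>u\<in>carrier Q - M. u \<otimes>\<^bsub>Q\<^esub> q z = \<zero>\<^bsub>Q\<^esub>"
    then obtain v where v: "v \<in> carrier Q - M" "v \<otimes>\<^bsub>Q\<^esub> q z = \<zero>\<^bsub>Q\<^esub>" by (rule bexE)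
    obtain u where u: "v = q u" using DiffD1[OF v(1)] unfolding carrier_Q by (rule rangeE)
    have "u * z \<in> J" using v(2) by (simp only: u q_mult q_eq_zero_iff)
    then show "\<exists>u. q u \<notin> M \<and> u * z \<in> J" using DiffD2[OF v(1)] unfolding u by blast
  next
    assume "\<exists>u. q u \<notin> M \<and> u * z \<in> J"
    then obtain u where u: "q u \<notin> M" "u * z \<in> J" by blast
    have "q u \<otimes>\<^bsub>Q\<^esub> q z = \<zero>\<^bsub>Q\<^esub>" using u(2) by (simp only: q_mult q_eq_zero_iff)
    then show "\<exists>u\<in>carrier Q - M. u \<otimes>\<^bsub>Q\<^esub> q z = \<zero>\<^bsub>Q\<^esub>"
      by (rule bexI) (use u(1) in simp)
  qed
  have "locally_regular M (q a) \<longleftrightarrow>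
    (\<forall>y. (\<exists>u\<in>carrier Q - M. u \<otimes>\<^bsub>Q\<^esub> q (a * y) = \<zero>\<^bsub>Q\<^esub>) \<longrightarrow> (\<exists>u\<in>carrier Q - M. u \<otimes>\<^bsub>Q\<^esub> q y = \<zero>\<^bsub>Q\<^esub>))"
    unfolding locally_regular_def by (simp only: carrier_Q ball_simps q_mult UNIV_I simp_thms)
  then show ?thesis unfolding * .
qed

text \<open>
  Elements outside the ideal of the vertex are regular, so being regular at the vertex is
  the same as being regular. Moreover \<open>x\<^sub>i\<close> is not nilpotent, so it divides a power of \<open>a\<close> up to such an
  element; what \<open>x\<^sub>i\<close> annihilates is then annihilated by the power of \<open>a\<close>, hence zero.
\<close>

lemma locally_regular_at_vertex:
  assumes a: "a \<in> vertex" "locally_regular vertex a" and xy: "pvar i * y \<in> J"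
  shows "y \<in> J"
proof -
  obtain a' where a': "a = q a'" using a(1) unfolding vertex_def by blast
  have cancel: "y \<in> J" if "a' * y \<in> J" for y
  proof -
    have "q 1 \<notin> vertex \<and> 1 * (a' * y) \<in> J" using that by (simp add: q_in_vertex_iff)
    then obtain u where "q u \<notin> vertex" "u * y \<in> J"
      using a(2) unfolding a' locally_regular_iff by blast
    then show ?thesis using cancel_unit_constant_term by (simp add: q_in_vertex_iff)
  qed
  have cancel_pow: "y \<in> J" if "a' ^ k * y \<in> J" for k y
    using that
  proof (induct k)
    case (Suc k)
    then have "a' * (a' ^ k * y) \<in> J" by (simp only: power_Suc mult.assoc)
    from cancel[OF this] show ?case by (rule Suc(1))
  qed simp
  have "q (pvar i) \<in> carrier Q - nilradical" using axis_poly_pvar by (simp add: q_in_nilradical_iff)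
  from power_times_unit_in_principal[OF maximalideal_vertex this a(1)]
  obtain k :: nat and u' w' where
    kuw: "q u' \<notin> vertex" "a [^]\<^bsub>Q\<^esub> k \<otimes>\<^bsub>Q\<^esub> q u' = q (pvar i) \<otimes>\<^bsub>Q\<^esub> q w'"
    unfolding carrier_Q by blast
  have u': "Poly_Mapping.lookup u' 0 \<noteq> 0" using kuw(1) by (simp only: q_in_vertex_iff not_False_eq_True)
  have "a' ^ k * u' - pvar i * w' \<in> J" using kuw(2) by (simp only: a' q_pow q_mult q_eq_iff)
  then have "y * (a' ^ k * u' - pvar i * w') + w' * (pvar i * y) \<in> J"
    using xy by (intro J_closed(1)[OF J_closed(2) J_closed(2)])
  moreover have "y * (a' ^ k * u' - pvar i * w') + w' * (pvar i * y) = u' * (a' ^ k * y)"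
    by (simp add: algebra_simps)
  ultimately have "u' * (a' ^ k * y) \<in> J" by (simp only:)
  from cancel_pow[OF cancel_unit_constant_term[OF u' this]] show "y \<in> J" .
qed

theorem cohen_macaulay_iff_pvar_regular:
  "cohen_macaulay Q \<longleftrightarrow> (\<forall>f. pvar i * f \<in> J \<longrightarrow> f \<in> J)"
proof -
  have "cohen_macaulay Q \<longleftrightarrow> (\<forall>M. maximalideal M Q \<longrightarrow> (\<exists>a\<in>M. locally_regular M a))"
    unfolding locally_regular_def
    by (rule cohen_macaulay_iff_locally_regular_element[OF cring_Q noetherian_Q[OF mpoly_ring_noetherian]
        primeideal_nilradical nilradical_nilpotent not_maximalideal_nilradical power_times_unit_in_principal])
  also have "\<dots> \<longleftrightarrow> (\<forall>f. pvar i * f \<in> J \<longrightarrow> f \<in> J)"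
  proof (intro iffI allI impI)
    fix y
    assume "\<forall>M. maximalideal M Q \<longrightarrow> (\<exists>a\<in>M. locally_regular M a)" and xy: "pvar i * y \<in> J"
    then obtain a where "a \<in> vertex" "locally_regular vertex a" using maximalideal_vertex by blast
    then show "y \<in> J" using xy by (rule locally_regular_at_vertex)
  next
    fix M
    assume xreg: "\<forall>f. pvar i * f \<in> J \<longrightarrow> f \<in> J" and M: "maximalideal M Q"
    from xreg obtain a where a: "q a \<in> M" "\<forall>y. a * y \<in> J \<longrightarrow> y \<in> J"
      using regular_in_maximal[OF _ M] by blast
    have "locally_regular M (q a)"
      unfolding locally_regular_iff
    proof (intro allI impI)
      fix y assume "\<exists>u. q u \<notin> M \<and> u * (a * y) \<in> J"
      then obtain u where u: "q u \<notin> M" "u * (a * y) \<in> J" by blast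
      have "a * (u * y) \<in> J" using u(2) by (simp only: mult.left_commute)
      then show "\<exists>u. q u \<notin> M \<and> u * y \<in> J" using u(1) a(2) by blast
    qed
    then show "\<exists>a\<in>M. locally_regular M a" using a(1) by blast
  qed
  finally show ?thesis .
qed

end

text \<open>
  The criterion in terms of the semigroup: the tangent cone is Cohen-Macaulay iff adding the
  smallest generator always raises the order by exactly one.
\<close>

theorem (in least_weight) cohen_macaulay_tangent_cone_curve_iff:
  "cohen_macaulay_tangent_cone (curve_ideal n :: ('v, 'k::field) mpoly set) \<longleftrightarrow>
    (\<forall>m. max_degree n (weight n m + n i) = Suc (max_degree n (weight n m)))"
proof -
  interpret tangent_cone n i "graded_kernel n :: ('v, 'k) mpoly set" by unfold_locales simp
  show ?thesis
    unfolding cohen_macaulay_tangent_cone_def tangent_ideal_curve_ideal cohen_macaulay_iff_pvar_regular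
    by (rule pvar_regular_iff)
qed

section \<open>Monomial curves in four-space with five binomial relations\<close>

text \<open>
  If the ideal is generated by differences of monomials, and if \<open>T\<close> is a union of components
  of the graph that joins \<open>c u\<close> to \<open>c v\<close> for each generator \<open>u - v\<close>, then the functional of \<open>T\<close>
  vanishes on the ideal. Applied to a binomial \<open>m - m'\<close> of the ideal, this shows that
  \<open>m\<close> and \<open>m'\<close> lie in the same component.
\<close>

lemma coeff_sum_ideal_zero:
  fixes G :: "('v::finite, 'k::comm_ring_1) mpoly set"
  assumes f: "f \<in> Idl\<^bsub>mpoly_ring\<^esub> G"
    and G: "\<And>g. g \<in> G \<Longrightarrow> \<exists>u v. g = Poly_Mapping.single u 1 - Poly_Mapping.single v 1 \<and>
      (\<forall>c. c + u \<in> T \<longleftrightarrow> c + v \<in> T)"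
  shows "coeff_sum T f = 0"
proof -
  \<comment> \<open>The largest ideal contained in the kernel of the functional.\<close>
  let ?N = "{f. \<forall>r. coeff_sum T (r * f) = 0}"
  have "ideal ?N (mpoly_ring :: ('v, 'k) mpoly ring)"
    by (auto simp: type_ring_ideal_iff distrib_left mult.assoc[symmetric])
  moreover have "G \<subseteq> ?N"
  proof (intro subsetI CollectI allI)
    fix g r assume "g \<in> G"
    then obtain u v where "g = Poly_Mapping.single u 1 - Poly_Mapping.single v 1"
      "\<forall>c. c + u \<in> T \<longleftrightarrow> c + v \<in> T" using G by blast
    then show "coeff_sum T (r * g) = 0" by (simp add: coeff_sum_times)
  qed
  ultimately have "f \<in> ?N" using type_ring_genideal(3)[of ?N G] f by blast
  then have "coeff_sum T (1 * f) = 0" by blast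
  then show ?thesis by simp
qed

lemma exhaust_4: "(x :: 4) = 1 \<or> x = 2 \<or> x = 3 \<or> x = 4"
proof (induct x)
  case (of_int z)
  then have "z = 0 \<or> z = 1 \<or> z = 2 \<or> z = 3" by fastforce
  then show ?case by auto
qed

lemma sum_4:
  fixes f :: "4 \<Rightarrow> 'a::comm_monoid_add"
  shows "(\<Sum>i\<in>UNIV. f i) = f 1 + f 2 + f 3 + f 4"
proof -
  have UNIV_4: "(UNIV :: 4 set) = {1, 2, 3, 4}" using exhaust_4 by auto
  show ?thesis
    unfolding UNIV_4 by (simp add: ac_simps)
qed

definition monomial4 :: "nat \<Rightarrow> nat \<Rightarrow> nat \<Rightarrow> nat \<Rightarrow> (4 \<Rightarrow>\<^sub>0 nat)" where
  "monomial4 a b c d = Poly_Mapping.single 1 a + Poly_Mapping.single 2 b + Poly_Mapping.single 3 c + Poly_Mapping.single 4 d"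

lemma lookup_monomial4 [simp]:
  "Poly_Mapping.lookup (monomial4 a b c d) 1 = a" "Poly_Mapping.lookup (monomial4 a b c d) 2 = b"
  "Poly_Mapping.lookup (monomial4 a b c d) 3 = c" "Poly_Mapping.lookup (monomial4 a b c d) 4 = d"
  by (simp_all add: monomial4_def lookup_add lookup_single when_def)

lemma monomial4_eq_iff [simp]: "monomial4 a b c d = monomial4 a' b' c' d' \<longleftrightarrow> a = a' \<and> b = b' \<and> c = c' \<and> d = d'"
  by (metis lookup_monomial4)

lemma monomial4_add [simp]: "monomial4 a b c d + monomial4 a' b' c' d' = monomial4 (a + a') (b + b') (c + c') (d + d')"
  by (simp add: monomial4_def single_add ac_simps)

lemma monomial4_cases: obtains a b c d where "m = monomial4 a b c d"
proof
  show "m = monomial4 (Poly_Mapping.lookup m 1) (Poly_Mapping.lookup m 2) (Poly_Mapping.lookup m 3) (Poly_Mapping.lookup m 4)"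
  proof (rule poly_mapping_eqI)
    fix k :: 4
    show "Poly_Mapping.lookup m k = Poly_Mapping.lookup (monomial4 (Poly_Mapping.lookup m 1) (Poly_Mapping.lookup m 2) (Poly_Mapping.lookup m 3) (Poly_Mapping.lookup m 4)) k"
      using exhaust_4[of k] by (elim disjE) (simp_all only: lookup_monomial4)
  qed
qed

lemma weight_monomial4 [simp]: "weight n (monomial4 a b c d) = n 1 * a + n 2 * b + n 3 * c + n 4 * d"
  unfolding weight_def sum_4 lookup_monomial4 ..

lemma total_degree_monomial4 [simp]: "total_degree (monomial4 a b c d) = a + b + c + d"
  unfolding total_degree_def sum_4 lookup_monomial4 ..

lemma pvar_power: "(pvar i :: ('v, 'k::comm_ring_1) mpoly) ^ a = Poly_Mapping.single (Poly_Mapping.single i a) 1"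
  by (induct a) (simp_all add: pvar_def mult_single single_add[symmetric])

text \<open>
  The monomials of the five generators, each pair to be used as a move in both directions.
\<close>

definition bresinsky_moves where
  "bresinsky_moves a1 a2 a3 a4 a12 a14 a21 a23 a31 a34 a42 a43 =
    {(monomial4 a1 0 0 0, monomial4 0 a12 0 a14), (monomial4 0 a2 0 0, monomial4 a21 0 a23 0),
     (monomial4 0 0 a3 0, monomial4 a31 0 0 a34), (monomial4 0 0 0 a4, monomial4 0 a42 a43 0),
     (monomial4 a31 a42 0 0, monomial4 0 0 a23 a14)}"

text \<open>
  The last two assumptions say that the moves preserve the weight, and that they connect any two
  monomials of equal weight (\<open>T\<close> ranges over the unions of components). This is all that enters of
  the ideal, so the field disappears from the argument.
\<close>

locale bresinsky_curve = least_weight n 1 for n :: "4 \<Rightarrow> nat" +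
  fixes a1 a2 a3 a4 a12 a14 a21 a23 a31 a34 a42 a43 :: nat
  assumes n_less: "n 1 < n 2" "n 2 < n 3" "n 3 < n 4"
    and a_pos: "0 < a12" "0 < a14" "0 < a21" "0 < a23" "0 < a31" "0 < a34" "0 < a42" "0 < a43"
    and a_sum: "a1 = a21 + a31" "a2 = a12 + a42" "a3 = a23 + a43" "a4 = a14 + a34"
    and move_weight: "(u, v) \<in> bresinsky_moves a1 a2 a3 a4 a12 a14 a21 a23 a31 a34 a42 a43 \<Longrightarrow>
      weight n u = weight n v"
    and move_connected: "\<lbrakk>\<And>u v c. (u, v) \<in> bresinsky_moves a1 a2 a3 a4 a12 a14 a21 a23 a31 a34 a42 a43 \<Longrightarrow>
        c + u \<in> T \<longleftrightarrow> c + v \<in> T; m \<in> T; weight n m = weight n m'\<rbrakk> \<Longrightarrow> m' \<in> T"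
begin

lemma weight_relations:
  "n 1 * a1 = n 2 * a12 + n 4 * a14" "n 2 * a2 = n 1 * a21 + n 3 * a23"
  "n 3 * a3 = n 1 * a31 + n 4 * a34" "n 4 * a4 = n 2 * a42 + n 3 * a43"
  "n 1 * a31 + n 2 * a42 = n 3 * a23 + n 4 * a14"
  using move_weight[of "monomial4 a1 0 0 0" "monomial4 0 a12 0 a14"] move_weight[of "monomial4 0 a2 0 0" "monomial4 a21 0 a23 0"]
    move_weight[of "monomial4 0 0 a3 0" "monomial4 a31 0 0 a34"] move_weight[of "monomial4 0 0 0 a4" "monomial4 0 a42 a43 0"]
    move_weight[of "monomial4 a31 a42 0 0" "monomial4 0 0 a23 a14"]
  by (simp_all add: bresinsky_moves_def)

text \<open>
  The inequalities that hold for every curve of this form: in a relation between weights, the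
  side with the larger generators has the smaller number of factors.
\<close>

lemma degree_inequalities: "a12 + a14 \<le> a1" "a4 \<le> a42 + a43" "a23 + a14 \<le> a31 + a42"
proof -
  have "n 1 * (a12 + a14) \<le> n 1 * a1"
    unfolding weight_relations(1) distrib_left by (intro add_mono mult_right_mono) (use n_less in auto)
  then show "a12 + a14 \<le> a1" using pos[of 1] by simp
  have "n 4 * a4 \<le> n 4 * (a42 + a43)"
    unfolding weight_relations(4) distrib_left by (intro add_mono mult_right_mono) (use n_less in auto)
  then show "a4 \<le> a42 + a43" using pos[of 4] by simp
  have "n 2 * (a23 + a14) \<le> n 3 * a23 + n 4 * a14"
    unfolding distrib_left by (intro add_mono mult_right_mono) (use n_less in auto)
  also have "\<dots> = n 1 * a31 + n 2 * a42" by (rule weight_relations(5)[symmetric])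
  also have "\<dots> \<le> n 2 * (a31 + a42)"
    unfolding distrib_left by (intro add_mono mult_right_mono) (use n_less in auto)
  finally show "a23 + a14 \<le> a31 + a42" using pos[of 2] by simp
qed

lemma move_connectedI:
  assumes "\<And>p q r s. monomial4 (p + a1) q r s \<in> T \<longleftrightarrow> monomial4 p (q + a12) r (s + a14) \<in> T"
    "\<And>p q r s. monomial4 p (q + a2) r s \<in> T \<longleftrightarrow> monomial4 (p + a21) q (r + a23) s \<in> T"
    "\<And>p q r s. monomial4 p q (r + a3) s \<in> T \<longleftrightarrow> monomial4 (p + a31) q r (s + a34) \<in> T"
    "\<And>p q r s. monomial4 p q r (s + a4) \<in> T \<longleftrightarrow> monomial4 p (q + a42) (r + a43) s \<in> T"
    "\<And>p q r s. monomial4 (p + a31) (q + a42) r s \<in> T \<longleftrightarrow> monomial4 p q (r + a23) (s + a14) \<in> T"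
    and "m \<in> T" "weight n m = weight n m'"
  shows "m' \<in> T"
proof (rule move_connected[OF _ assms(6,7)])
  fix u v c assume uv: "(u, v) \<in> bresinsky_moves a1 a2 a3 a4 a12 a14 a21 a23 a31 a34 a42 a43"
  obtain p q r s where c: "c = monomial4 p q r s" by (rule monomial4_cases)
  show "c + u \<in> T \<longleftrightarrow> c + v \<in> T"
    using uv assms(1-5)[of p q r s] unfolding bresinsky_moves_def c
    by (elim insertE emptyE Pair_inject) (simp_all only: monomial4_add add_0_right)
qed

text \<open>
  No monomial of a generator divides such a monomial, so it is a component by itself.
\<close>

lemma isolated_monomial:
  assumes "c < a3" "d < a4" "c < a23 \<or> d < a14" "weight n m = weight n (monomial4 0 0 c d)"
  shows "m = monomial4 0 0 c d"
proof -
  have "m \<in> {monomial4 0 0 c d}"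
    by (rule move_connectedI[OF _ _ _ _ _ _ assms(4)[symmetric]])
      (use assms(1-3) a_pos a_sum in auto)
  then show ?thesis by simp
qed

lemma max_degree_add_x1:
  assumes C: "\<forall>m. max_degree n (weight n m + n 1) = Suc (max_degree n (weight n m))"
  shows "max_degree n (weight n m + n 1 * j) = max_degree n (weight n m) + j"
proof (induct j)
  case (Suc j)
  have "weight n (m + Poly_Mapping.single 1 j) = weight n m + n 1 * j" by simp
  then have "max_degree n (weight n m + n 1 * j + n 1) = Suc (max_degree n (weight n m + n 1 * j))"
    using C by metis
  then show ?case using Suc by (simp add: algebra_simps)
qed simp

text \<open>
  The monomials \<open>x\<^sub>3\<^bsup>a23\<^esup>\<close> and \<open>x\<^sub>4\<^bsup>a34\<^esup>\<close> are isolated, so their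
  degrees are maximal. If multiplication by \<open>x\<^sub>1\<close> preserves maximality, the second monomials of
  the second and the third generator have maximal degrees as well, and these bound the degrees of the
  first monomials, which have the same weights.
\<close>

lemma exponents_le_of_regular:
  assumes C: "\<forall>m. max_degree n (weight n m + n 1) = Suc (max_degree n (weight n m))"
  shows "a2 \<le> a21 + a23" "a3 \<le> a31 + a34"
proof -
  have isolated: "max_degree n (weight n (monomial4 0 0 c d)) = c + d"
    if "c < a3" "d < a4" "c < a23 \<or> d < a14" for c d
  proof -
    obtain k where "k \<in> top_monomials n (weight n (monomial4 0 0 c d))" using top_monomials_nonempty by blast
    then have "weight n k = weight n (monomial4 0 0 c d)" "total_degree k = max_degree n (weight n (monomial4 0 0 c d))"
      by (simp_all add: top_monomials_def)
    then show ?thesis using isolated_monomial[OF that, of k] by (metis total_degree_monomial4 add_0)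
  qed
  have "a2 \<le> max_degree n (weight n (monomial4 0 0 a23 0) + n 1 * a21)"
    using total_degree_le_max[of "monomial4 0 a2 0 0"] weight_relations(2) by (simp add: add.commute)
  also have "\<dots> = a23 + a21"
    unfolding max_degree_add_x1[OF C] using isolated[of a23 0] a_pos a_sum by simp
  finally show "a2 \<le> a21 + a23" by simp
  have "a3 \<le> max_degree n (weight n (monomial4 0 0 0 a34) + n 1 * a31)"
    using total_degree_le_max[of "monomial4 0 0 a3 0"] weight_relations(3) by (simp add: add.commute)
  also have "\<dots> = a34 + a31"
    unfolding max_degree_add_x1[OF C] using isolated[of 0 a34] a_pos a_sum by simp
  finally show "a3 \<le> a31 + a34" by simp
qed

text \<open>
  A monomial whose weight exceeds an element of the semigroup by \<open>n 1\<close> can be replaced by a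
  multiple of \<open>x\<^sub>1\<close> of the same weight and at least the same degree. If it is divisible by one of
  \<open>x\<^sub>2\<^bsup>a2\<^esup>\<close>, \<open>x\<^sub>3\<^bsup>a3\<^esup>\<close>, \<open>x\<^sub>2\<^bsup>a12\<^esup> x\<^sub>4\<^bsup>a14\<^esup>\<close>, \<open>x\<^sub>3\<^bsup>a23\<^esup> x\<^sub>4\<^bsup>a14\<^esup>\<close>, a single move
  achieves this. If it is divisible by \<open>x\<^sub>4\<^bsup>a4\<^esup>\<close>, a move lowers the exponent of \<open>x\<^sub>4\<close>. In the
  remaining case, if \<open>x\<^sub>1\<close> does not divide it already, the only moves are
  repetitions of the fourth one from right to left, and they never produce \<open>x\<^sub>1\<close>: this is
  impossible, since some monomial of the same weight is a multiple of \<open>x\<^sub>1\<close>.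
\<close>

lemma divide_out_x1:
  assumes le: "a2 \<le> a21 + a23" "a3 \<le> a31 + a34"
    and "weight n (monomial4 a b c d) = weight n k + n 1"
  shows "\<exists>m'. weight n m' + n 1 = weight n (monomial4 a b c d) \<and> total_degree (monomial4 a b c d) \<le> total_degree m' + 1"
  using assms(3)
proof (induct d arbitrary: a b c rule: less_induct)
  case (less d)
  have minus1: "n 1 * (x - 1) + n 1 = n 1 * x" if "0 < x" for x
    using that by (cases x) simp_all
  have by_move: ?case
    if "0 < p" "weight n (monomial4 p q r s) = weight n (monomial4 a b c d)" "a + b + c + d \<le> p + q + r + s" for p q r s
    using that minus1[OF that(1)] by (intro exI[of _ "monomial4 (p - 1) q r s"]) simp
  note rel = weight_relations degree_inequalities
  consider "0 < a" | "a2 \<le> b" | "a3 \<le> c" | "a12 \<le> b" "a14 \<le> d" | "a23 \<le> c" "a14 \<le> d" | "a4 \<le> d"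
    | "a = 0" "b < a2" "c < a3" "d < a4" "b < a12 \<or> d < a14" "c < a23 \<or> d < a14"
    by linarith
  then show ?case
  proof cases
    case 1
    then show ?thesis by (intro by_move) auto
  next
    case 2
    then obtain b' where b: "b = b' + a2" by (metis le_iff_add add.commute)
    show ?thesis
      using rel(2) le a_pos by (intro by_move[of "a + a21" b' "c + a23" d]) (auto simp: b algebra_simps)
  next
    case 3
    then obtain c' where c: "c = c' + a3" by (metis le_iff_add add.commute)
    show ?thesis
      using rel(3) le a_pos by (intro by_move[of "a + a31" b c' "d + a34"]) (auto simp: c algebra_simps)
  next
    case 4
    then obtain b' d' where bd: "b = b' + a12" "d = d' + a14" by (metis le_iff_add add.commute)
    show ?thesis
      using rel(1,6) a_pos a_sum by (intro by_move[of "a + a1" b' c d']) (auto simp: bd algebra_simps)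
  next
    case 5
    then obtain c' d' where cd: "c = c' + a23" "d = d' + a14" by (metis le_iff_add add.commute)
    show ?thesis
      using rel(5,8) a_pos by (intro by_move[of "a + a31" "b + a42" c' d']) (auto simp: cd algebra_simps)
  next
    case 6
    then obtain d' where d: "d = d' + a4" by (metis le_iff_add add.commute)
    have w: "weight n (monomial4 a (b + a42) (c + a43) d') = weight n (monomial4 a b c d)"
      using rel(4) by (simp add: d algebra_simps)
    have "d' < d" using a_pos a_sum d by simp
    from less(1)[OF this, of a "b + a42" "c + a43"] less(2)
    obtain m' where m': "weight n m' + n 1 = weight n (monomial4 a b c d)"
      "total_degree (monomial4 a (b + a42) (c + a43) d') \<le> total_degree m' + 1"
      unfolding w by blast
    then show ?thesis using rel(7) by (intro exI[of _ m']) (simp add: d)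
  next
    case 7
    \<comment> \<open>The component of the monomial: all monomials reached from it by \<open>j\<close> moves from \<open>x\<^sub>2\<^bsup>a42\<^esup> x\<^sub>3\<^bsup>a43\<^esup>\<close> to \<open>x\<^sub>4\<^bsup>a4\<^esup>\<close>.\<close>
    define T where "T = {monomial4 0 q r s | q r s. \<exists>j. q + j * a42 = b \<and> r + j * a43 = c \<and> s = d + j * a4}"
    have T: "monomial4 p q r s \<in> T \<longleftrightarrow> p = 0 \<and> (\<exists>j. q + j * a42 = b \<and> r + j * a43 = c \<and> s = d + j * a4)" for p q r s
      by (auto simp: T_def)
    have "monomial4 a b c d \<in> T" using 7(1) by (auto simp: T intro: exI[of _ 0])
    moreover have "weight n (monomial4 a b c d) = weight n (k + Poly_Mapping.single 1 1)" using less(2) by simp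
    ultimately have "k + Poly_Mapping.single 1 1 \<in> T"
    proof (rule move_connectedI[rotated 5])
      fix p q r s
      \<comment> \<open>For \<open>j = 0\<close> the move was excluded by cases; after a first move, the exponent of \<open>x\<^sub>2\<close> is below \<open>a12\<close>.\<close>
      have no: "\<not> (q + a12 + j * a42 = b \<and> s + a14 = d + j * a4)" for j
        using 7(2,4,5) a_sum by (cases j) auto
      have "p + a1 \<noteq> 0" using a_pos a_sum by simp
      then show "monomial4 (p + a1) q r s \<in> T \<longleftrightarrow> monomial4 p (q + a12) r (s + a14) \<in> T"
        unfolding T using no by blast
      show "monomial4 p (q + a2) r s \<in> T \<longleftrightarrow> monomial4 (p + a21) q (r + a23) s \<in> T"
        using 7(2) a_pos unfolding T by auto
      show "monomial4 p q (r + a3) s \<in> T \<longleftrightarrow> monomial4 (p + a31) q r (s + a34) \<in> T"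
        using 7(3) a_pos unfolding T by auto
      \<comment> \<open>Likewise, after a first move the exponent of \<open>x\<^sub>3\<close> is below \<open>a23\<close>.\<close>
      have no: "\<not> (r + a23 + j * a43 = c \<and> s + a14 = d + j * a4)" for j
        using 7(3,4,6) a_sum by (cases j) auto
      have "p + a31 \<noteq> 0" using a_pos by simp
      then show "monomial4 (p + a31) (q + a42) r s \<in> T \<longleftrightarrow> monomial4 p q (r + a23) (s + a14) \<in> T"
        unfolding T using no by blast
      show "monomial4 p q r (s + a4) \<in> T \<longleftrightarrow> monomial4 p (q + a42) (r + a43) s \<in> T"
      proof
        assume "monomial4 p q r (s + a4) \<in> T"
        then obtain j where j: "p = 0" "q + j * a42 = b" "r + j * a43 = c" "s + a4 = d + j * a4"
          unfolding T by blast
        then obtain j' where "j = Suc j'" using 7(4) by (cases j) auto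
        then show "monomial4 p (q + a42) (r + a43) s \<in> T"
          unfolding T using j by (intro conjI exI[of _ j']) auto
      next
        assume "monomial4 p (q + a42) (r + a43) s \<in> T"
        then obtain j where j: "p = 0" "q + a42 + j * a42 = b" "r + a43 + j * a43 = c" "s = d + j * a4"
          unfolding T by blast
        then show "monomial4 p q r (s + a4) \<in> T"
          unfolding T by (intro conjI exI[of _ "Suc j"]) auto
      qed
    qed
    then have "Poly_Mapping.lookup (k + Poly_Mapping.single 1 1) 1 = 0" by (auto simp: T_def)
    then show ?thesis by (simp add: lookup_add)
  qed
qed

text \<open>
  One inequality between the maximal degrees holds always, by multiplication with \<open>x\<^sub>1\<close>. The
  other one means that \<open>x\<^sub>1\<close> can be divided out of some monomial of maximal degree.
\<close>

theorem max_degree_regular_iff: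
  "(\<forall>m. max_degree n (weight n m + n 1) = Suc (max_degree n (weight n m))) \<longleftrightarrow>
    a2 \<le> a21 + a23 \<and> a3 \<le> a31 + a34"
proof
  assume le: "a2 \<le> a21 + a23 \<and> a3 \<le> a31 + a34"
  show "\<forall>m. max_degree n (weight n m + n 1) = Suc (max_degree n (weight n m))"
  proof
    fix m
    have "Suc (max_degree n (weight n m)) \<le> max_degree n (weight n m + n 1)"
      using max_degree_add[of "Poly_Mapping.single 1 1" m] by (simp add: add.commute)
    moreover obtain M where M: "weight n M = weight n m + n 1" "total_degree M = max_degree n (weight n m + n 1)"
      using top_monomials_nonempty[of "m + Poly_Mapping.single 1 1"] by (auto simp: top_monomials_def)
    obtain a b c d where "M = monomial4 a b c d" by (rule monomial4_cases)
    with M(1) obtain m' where m': "weight n m' + n 1 = weight n M" "total_degree M \<le> total_degree m' + 1"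
      using divide_out_x1[of a b c d m] le by auto
    then have "max_degree n (weight n m + n 1) \<le> Suc (max_degree n (weight n m))"
      using total_degree_le_max[of m'] M by simp
    ultimately show "max_degree n (weight n m + n 1) = Suc (max_degree n (weight n m))" by simp
  qed
qed (use exponents_le_of_regular in blast)

end

theorem theorem3p29:
  fixes n :: "4 \<Rightarrow> nat"
    and I :: "(4, 'k::field) mpoly set"
    and a1 a2 a3 a4 a12 a14 a21 a23 a31 a34 a42 a43 :: nat
  assumes "\<forall>i. 0 < n i" and "Gcd (range n) = 1"
    and "n 1 < n 2" and "n 2 < n 3" and "n 3 < n 4"
    and "I = curve_ideal n"
    and "gorenstein_curve n"
    and "\<not> complete_intersection_curve I"
    and "0 < a12" "a12 < a2" "0 < a14" "a14 < a4"
    and "0 < a21" "a21 < a1" "0 < a23" "a23 < a3"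
    and "0 < a31" "a31 < a1" "0 < a34" "a34 < a4"
    and "0 < a42" "a42 < a2" "0 < a43" "a43 < a3"
    and "a1 = a21 + a31" "a2 = a12 + a42" "a3 = a23 + a43" "a4 = a14 + a34"
    and "minimally_generates
           {pvar 1 ^ a1 - pvar 2 ^ a12 * pvar 4 ^ a14,
            pvar 2 ^ a2 - pvar 1 ^ a21 * pvar 3 ^ a23,
            pvar 3 ^ a3 - pvar 1 ^ a31 * pvar 4 ^ a34,
            pvar 4 ^ a4 - pvar 2 ^ a42 * pvar 3 ^ a43,
            pvar 1 ^ a31 * pvar 2 ^ a42 - pvar 3 ^ a23 * pvar 4 ^ a14} I"
  shows "cohen_macaulay_tangent_cone I \<longleftrightarrow> a2 \<le> a21 + a23 \<and> a3 \<le> a31 + a34"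
proof -
  let ?moves = "bresinsky_moves a1 a2 a3 a4 a12 a14 a21 a23 a31 a34 a42 a43"
  let ?bin = "\<lambda>(u, v). Poly_Mapping.single u 1 - Poly_Mapping.single v 1 :: (4, 'k) mpoly"
  have gens: "Idl\<^bsub>mpoly_ring\<^esub> (?bin ` ?moves) = (curve_ideal n :: (4, 'k) mpoly set)"
    using assms(6) \<open>minimally_generates _ I\<close>
    by (simp add: minimally_generates_def bresinsky_moves_def monomial4_def pvar_power mult_single)
  have n_less: "n 1 < n j" if "j \<noteq> 1" for j
    using exhaust_4[of j] that assms(3-5) by auto
  interpret positive_weights n by unfold_locales (use assms(1) in simp)
  interpret bresinsky_curve n a1 a2 a3 a4 a12 a14 a21 a23 a31 a34 a42 a43
  proof unfold_locales
    fix u v assume "(u, v) \<in> ?moves"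
    then have "?bin (u, v) \<in> (curve_ideal n :: (4, 'k) mpoly set)"
      using type_ring_genideal(2)[of "?bin ` ?moves"] unfolding gens by blast
    then have "coeff_sum {m. weight n m = weight n u} (?bin (u, v)) = 0"
      unfolding curve_ideal_iff by blast
    then show "weight n u = weight n v" by (simp split: if_splits)
  next
    fix T m m'
    assume T: "\<And>u v c. (u, v) \<in> ?moves \<Longrightarrow> c + u \<in> T \<longleftrightarrow> c + v \<in> T" and m: "m \<in> T" "weight n m = weight n m'"
    have "?bin (m, m') \<in> Idl\<^bsub>mpoly_ring\<^esub> (?bin ` ?moves)"
      unfolding gens using binomial_in_curve_ideal[OF m(2), of 1] by simp
    then have "coeff_sum T (?bin (m, m')) = 0"
    proof (rule coeff_sum_ideal_zero)
      fix g assume "g \<in> ?bin ` ?moves"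
      then obtain p where p: "g = ?bin p" "p \<in> ?moves" by (rule imageE)
      obtain u v where "p = (u, v)" by (cases p)
      with p show "\<exists>u v. g = Poly_Mapping.single u 1 - Poly_Mapping.single v 1 \<and> (\<forall>c. c + u \<in> T \<longleftrightarrow> c + v \<in> T)"
        using T by (intro exI[of _ u] exI[of _ v]) simp
    qed
    then show "m' \<in> T" using m(1) by (simp split: if_splits)
  qed (use assms n_less in auto)
  show ?thesis
    unfolding assms(6) cohen_macaulay_tangent_cone_curve_iff by (rule max_degree_regular_iff)
qed

end
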